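(* Consider an IMEX-MRI-SR method with $s^{\{S\}}$ slow stages, coefficient matrices $\Omega^{\{0\}},\dots,\Omega^{\{n_\Omega-1\}},\Gamma$ and abscissae $c^{\{S\}}$, whose fast subproblems are each solved by one step of a Runge--Kutta method $(A^{\{F\}},b^{\{F\}},c^{\{F\}})$. Suppose that the method is internally consistent, that its slow base method is third-order accurate, and that the fast Runge--Kutta method is accurate of order $\max(3,n_\Omega+1)$. If $$e_{s^{\{S\}}}^T\left(\sum_{k=0}^{n_\Omega-1}\frac{1}{(k+1)(k+2)}\,\Omega^{\{k\}}\right)c^{\{S\}}=\frac16,$$ where $e_{s^{\{S\}}}\in\mathbb{R}^{s^{\{S\}}}$ is the last standard basis vector, then the IMEX-MRI-SR method is third-order accurate.
   Context: The problem class is $y'(t)=f^{\{F\}}(t,y)+f^{\{I\}}(t,y)+f^{\{E\}}(t,y)$, $y(t_0)=y_0$, with $y(t)\in\mathbb{R}^d$ ($d$ arbitrary) and sufficiently smooth right-hand sides. An IMEX-MRI-SR (implicit-explicit multirate infinitesimal stage-restart) method is given by strictly lower-triangular real $s^{\{S\}}\times s^{\{S\}}$ matrices $\Omega^{\{k\}}=(\omega^{\{k\}}_{i,j})$, $k=0,\dots,n_\Omega-1$ ($n_\Omega\ge 1$), a lower-triangular real $s^{\{S\}}\times s^{\{S\}}$ matrix $\Gamma=(\gamma_{i,j})$ whose first row is zero, and $c^{\{S\}}\in\mathbb{R}^{s^{\{S\}}}$ with $c^{\{S\}}_1=0$ and $c^{\{S\}}_i\neq0$ for $i\ge2$. Put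 $\omega_{i,j}(\tau)=\sum_{k=0}^{n_\Omega-1}\omega^{\{k\}}_{i,j}\tau^k$, $\overline{\Omega}=\sum_{k=0}^{n_\Omega-1}\frac{1}{k+1}\Omega^{\{k\}}$, $C^{\{S\}}=\operatorname{diag}(c^{\{S\}})$. One step from $t_n$ to $t_n+H$ is: $Y_1^{\{S\}}=y_n$; for $i=2,\dots,s^{\{S\}}$, solve from $\theta=0$ to $\theta=c^{\{S\}}_iH$ $$v_i'(\theta)=f^{\{F\}}(t_n+\theta,v_i(\theta))+\frac{1}{c^{\{S\}}_i}\sum_{j=1}^{i-1}\omega_{i,j}\!\left(\frac{\theta}{c^{\{S\}}_iH}\right)\left(f^{\{E\}}_j+f^{\{I\}}_j\right),\qquad v_i(0)=y_n,$$ and then solve $Y^{\{S\}}_i=v_i(c^{\{S\}}_iH)+H\sum_{j=1}^{i}\gamma_{i,j}f^{\{I\}}_j$; finally $y_{n+1}=Y^{\{S\}}_{s^{\{S\}}}$. Here $f^{\{\sigma\}}_j=f^{\{\sigma\}}(t_n+c^{\{S\}}_jH,Y^{\{S\}}_j)$ for $\sigma\in\{E,I\}$. Fast solver: each fast initial-value problem is solved by a single step (of size $c_i^{\{S\}}H$) of the Runge--Kutta method $(A^{\{F\}},b^{\{F\}},c^{\{F\}})$ with $s^{\{F\}}$ stages and $c^{\{F\}}=A^{\{F\}}\mathbb{1}$. That is, with fast stages $$V_{i,j}=y_n+c^{\{S\}}_iH\sum_{k}a^{\{F\}}_{j,k}f^{\{F\}}_{i,k}+H\sum_{k}a^{\{F\}}_{j,k}\sum_{\ell=1}^{i-1}\omega_{i,\ell}(c^{\{F\}}_k)\left(f^{\{E\}}_\ell+f^{\{I\}}_\ell\right),$$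 $f^{\{F\}}_{i,k}=f^{\{F\}}(t_n+c^{\{S\}}_ic^{\{F\}}_kH,V_{i,k})$, the value $v_i(c_i^{\{S\}}H)$ is $y_n+c^{\{S\}}_iH\sum_j b^{\{F\}}_jf^{\{F\}}_{i,j}+H\sum_j b^{\{F\}}_j\sum_{\ell=1}^{i-1}\omega_{i,\ell}(c^{\{F\}}_j)(f^{\{E\}}_\ell+f^{\{I\}}_\ell)$. GARK form: with $\otimes$ the Kronecker product and $c^{\{F\}\times k}$ the element-wise $k$-th power, $\mathbf{A}^{\{F,F\}}=C^{\{S\}}\otimes A^{\{F\}}$, $\mathbf{A}^{\{F,E\}}=\mathbf{A}^{\{F,I\}}=\sum_{k=0}^{n_\Omega-1}\Omega^{\{k\}}\otimes(A^{\{F\}}c^{\{F\}\times k})$, $\mathbf{A}^{\{S,F\}}=C^{\{S\}}\otimes b^{\{F\},T}$, $\mathbf{A}^{\{S,E\}}=\overline{\Omega}$, $\mathbf{A}^{\{S,I\}}=\overline{\Omega}+\Gamma$, and $\mathbf{b}^{\{\nu\},T}=e_{s^{\{S\}}}^T\mathbf{A}^{\{S,\nu\}}$ for $\nu\in\{F,E,I\}$. With $\mathbf{c}^{\{\sigma,\nu\}}$ the vector of row sums of $\mathbf{A}^{\{\sigma,\nu\}}$, the method is internally consistent if $\mathbf{c}^{\{F,F\}}=\mathbf{c}^{\{F,E\}}=\mathbf{c}^{\{F,I\}}$ and $\mathbf{c}^{\{S,F\}}=\mathbf{c}^{\{S,E\}}=\mathbf{c}^{\{S,I\}}$ (the latter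 common vector being $c^{\{S\}}$). The slow base method is the additive Runge--Kutta (ARK) method for $y'=f^{\{E\}}+f^{\{I\}}$ (obtained when $f^{\{F\}}=0$) with explicit tableau $A^{\{E\}}=\overline{\Omega}$, $b^{\{E\},T}=e_{s^{\{S\}}}^T\overline{\Omega}$, $c^{\{E\}}=\overline{\Omega}\mathbb{1}$ and implicit tableau $A^{\{I\}}=\overline{\Omega}+\Gamma$, $b^{\{I\},T}=e_{s^{\{S\}}}^T(\overline{\Omega}+\Gamma)$, $c^{\{I\}}=(\overline{\Omega}+\Gamma)\mathbb{1}$; its order is that of an ARK method (including the coupling conditions between the two tableaux). A method is accurate of order $p$ if for all sufficiently smooth right-hand sides its one-step local error starting from exact data is $O(H^{p+1})$ as $H\to0$, equivalently (for Runge--Kutta, ARK and GARK methods as here) if all algebraic order conditions through order $p$ hold. *)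

theory Defs
  imports "HOL-Analysis.Analysis"
begin

section \<open>Smooth initial-value problems and local error\<close>

type_synonym 'd rhs = "real \<Rightarrow> real ^ 'd \<Rightarrow> real ^ 'd"

text \<open>
  Class \<open>C\<^sup>m\<close> on a Euclidean space. The derivative is taken direction by direction so that the
  type of the function does not change along the recursion; in finite dimension this agrees
  with continuity of the iterated Frechet derivatives.
\<close>

primrec Cm :: "nat \<Rightarrow> ('a::euclidean_space \<Rightarrow> 'b::euclidean_space) \<Rightarrow> bool" where
  "Cm 0 f \<longleftrightarrow> continuous_on UNIV f"
| "Cm (Suc m) f \<longleftrightarrow>
     (\<forall>x. f differentiable (at x)) \<and> (\<forall>v. Cm m (\<lambda>x. frechet_derivative f (at x) v))"

definition smooth_rhs :: "nat \<Rightarrow> ('d::finite) rhs \<Rightarrow> bool" where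
  "smooth_rhs m f \<longleftrightarrow> Cm m (\<lambda>(t, x). f t x)"

definition exact_solution :: "('d::finite) rhs \<Rightarrow> real \<Rightarrow> real \<Rightarrow> (real \<Rightarrow> real ^ 'd) \<Rightarrow> bool" where
  "exact_solution f t0 T y \<longleftrightarrow>
     T > 0 \<and> (\<forall>t\<in>{t0..t0+T}. (y has_vector_derivative f t (y t)) (at t within {t0..t0+T}))"

text \<open>
  The local error, from exact data at \<open>t0\<close>, is \<open>O(H\<^sup>p\<^sup>+\<^sup>1)\<close> as \<open>H\<close> tends to \<open>0\<close> from above.
  \<open>step r H y1\<close> is meant to say that \<open>y1\<close> is the result of one step of size \<open>H\<close> whose stages all
  lie within distance \<open>r\<close> of the initial value. The radius is needed because implicit stage
  equations can have spurious solutions far from the initial value, to which an error bound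
  does not apply; the existence clause says that the step is well defined for small \<open>H\<close>.
\<close>

definition local_error_order ::
  "nat \<Rightarrow> (real \<Rightarrow> real ^ 'd) \<Rightarrow> real \<Rightarrow> (real \<Rightarrow> real \<Rightarrow> real ^ ('d::finite) \<Rightarrow> bool) \<Rightarrow> bool" where
  "local_error_order p y t0 step \<longleftrightarrow>
     (\<exists>r>0. \<exists>C. eventually (\<lambda>H. (\<exists>y1. step r H y1) \<and>
        (\<forall>y1. step r H y1 \<longrightarrow> norm (y1 - y (t0 + H)) \<le> C * H ^ (p + 1))) (at_right 0))"

text \<open>
  All stage indices run through \<open>{1..s}\<close>; a tableau is a function \<open>nat \<Rightarrow> nat \<Rightarrow> real\<close> of which only
  the entries with indices in this range are ever used.

  In the order notions below the dimension is the cardinality of the type \<open>'d\<close>, passed as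
  \<open>TYPE('d)\<close>. Since HOL has no quantification over types inside a formula, an
  order hypothesis stated for \<open>TYPE('d)\<close> concerns systems of that one dimension, which is weaker
  than the same hypothesis for all dimensions. \<open>Sufficiently smooth\<close> means \<open>C\<^sup>m\<close> for
  some \<open>m\<close> that does not depend on the problem.
\<close>

section \<open>Runge-Kutta methods\<close>

definition row_sum :: "'j set \<Rightarrow> ('i \<Rightarrow> 'j \<Rightarrow> real) \<Rightarrow> 'i \<Rightarrow> real" where
  "row_sum J M i = (\<Sum>j\<in>J. M i j)"

text \<open>The abscissae of a tableau \<open>A\<close> are \<open>c = A 1\<close>.\<close>

abbreviation abscissae :: "nat \<Rightarrow> (nat \<Rightarrow> nat \<Rightarrow> real) \<Rightarrow> nat \<Rightarrow> real" where
  "abscissae s A \<equiv> row_sum {1..s} A"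

definition rk_stages ::
  "nat \<Rightarrow> (nat \<Rightarrow> nat \<Rightarrow> real) \<Rightarrow> ('d::finite) rhs \<Rightarrow> real \<Rightarrow> real ^ 'd \<Rightarrow> real \<Rightarrow> (nat \<Rightarrow> real ^ 'd) \<Rightarrow> bool"
where
  "rk_stages s A f t y h V \<longleftrightarrow>
     (\<forall>j\<in>{1..s}. V j = y + h *\<^sub>R (\<Sum>k=1..s. A j k *\<^sub>R f (t + abscissae s A k * h) (V k)))"

definition rk_result ::
  "nat \<Rightarrow> (nat \<Rightarrow> nat \<Rightarrow> real) \<Rightarrow> (nat \<Rightarrow> real) \<Rightarrow> ('d::finite) rhs \<Rightarrow> real \<Rightarrow> real ^ 'd \<Rightarrow> real
     \<Rightarrow> (nat \<Rightarrow> real ^ 'd) \<Rightarrow> real ^ 'd"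
where
  "rk_result s A b f t y h V = y + h *\<^sub>R (\<Sum>j=1..s. b j *\<^sub>R f (t + abscissae s A j * h) (V j))"

definition rk_step ::
  "nat \<Rightarrow> (nat \<Rightarrow> nat \<Rightarrow> real) \<Rightarrow> (nat \<Rightarrow> real) \<Rightarrow> ('d::finite) rhs \<Rightarrow> real \<Rightarrow> real ^ 'd
     \<Rightarrow> real \<Rightarrow> real \<Rightarrow> real ^ 'd \<Rightarrow> bool"
where
  "rk_step s A b f t y r H y1 \<longleftrightarrow>
     (\<exists>V. rk_stages s A f t y H V \<and> (\<forall>j\<in>{1..s}. norm (V j - y) \<le> r) \<and>
          y1 = rk_result s A b f t y H V)"

definition rk_accurate ::
  "('d::finite) itself \<Rightarrow> nat \<Rightarrow> (nat \<Rightarrow> nat \<Rightarrow> real) \<Rightarrow> (nat \<Rightarrow> real) \<Rightarrow> nat \<Rightarrow> bool"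
where
  "rk_accurate TYPE('d) s A b p \<longleftrightarrow>
     (\<exists>m. \<forall>(f :: 'd rhs) t0 T y.
        smooth_rhs m f \<longrightarrow> exact_solution f t0 T y \<longrightarrow>
        local_error_order p y t0 (rk_step s A b f t0 (y t0)))"

section \<open>Additive Runge-Kutta methods with two tableaux\<close>

definition ark_stages ::
  "nat \<Rightarrow> (nat \<Rightarrow> nat \<Rightarrow> real) \<Rightarrow> (nat \<Rightarrow> nat \<Rightarrow> real) \<Rightarrow> ('d::finite) rhs \<Rightarrow> 'd rhs
     \<Rightarrow> real \<Rightarrow> real ^ 'd \<Rightarrow> real \<Rightarrow> (nat \<Rightarrow> real ^ 'd) \<Rightarrow> bool"
where
  "ark_stages s aE aI fE fI t y H Y \<longleftrightarrow>
     (\<forall>i\<in>{1..s}. Y i = y + H *\<^sub>R (\<Sum>j=1..s. aE i j *\<^sub>R fE (t + abscissae s aE j * H) (Y j)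
                                       + aI i j *\<^sub>R fI (t + abscissae s aI j * H) (Y j)))"

definition ark_step ::
  "nat \<Rightarrow> (nat \<Rightarrow> nat \<Rightarrow> real) \<Rightarrow> (nat \<Rightarrow> real) \<Rightarrow> (nat \<Rightarrow> nat \<Rightarrow> real) \<Rightarrow> (nat \<Rightarrow> real)
     \<Rightarrow> ('d::finite) rhs \<Rightarrow> 'd rhs \<Rightarrow> real \<Rightarrow> real ^ 'd \<Rightarrow> real \<Rightarrow> real \<Rightarrow> real ^ 'd \<Rightarrow> bool"
where
  "ark_step s aE bE aI bI fE fI t y r H y1 \<longleftrightarrow>
     (\<exists>Y. ark_stages s aE aI fE fI t y H Y \<and> (\<forall>i\<in>{1..s}. norm (Y i - y) \<le> r) \<and>
          y1 = y + H *\<^sub>R (\<Sum>j=1..s. bE j *\<^sub>R fE (t + abscissae s aE j * H) (Y j)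
                                    + bI j *\<^sub>R fI (t + abscissae s aI j * H) (Y j)))"

definition ark_accurate ::
  "('d::finite) itself \<Rightarrow> nat \<Rightarrow> (nat \<Rightarrow> nat \<Rightarrow> real) \<Rightarrow> (nat \<Rightarrow> real)
     \<Rightarrow> (nat \<Rightarrow> nat \<Rightarrow> real) \<Rightarrow> (nat \<Rightarrow> real) \<Rightarrow> nat \<Rightarrow> bool"
where
  "ark_accurate TYPE('d) s aE bE aI bI p \<longleftrightarrow>
     (\<exists>m. \<forall>(fE :: 'd rhs) fI t0 T y.
        smooth_rhs m fE \<longrightarrow> smooth_rhs m fI \<longrightarrow>
        exact_solution (\<lambda>t x. fE t x + fI t x) t0 T y \<longrightarrow>
        local_error_order p y t0 (ark_step s aE bE aI bI fE fI t0 (y t0)))"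

section \<open>IMEX-MRI-SR methods\<close>

text \<open>\<open>\<Omega> k i j\<close> is the entry \<open>(i, j)\<close> of the matrix with index \<open>k\<close>, for \<open>k < n\<close>.\<close>

definition imex_mri_sr ::
  "nat \<Rightarrow> nat \<Rightarrow> (nat \<Rightarrow> nat \<Rightarrow> nat \<Rightarrow> real) \<Rightarrow> (nat \<Rightarrow> nat \<Rightarrow> real) \<Rightarrow> (nat \<Rightarrow> real) \<Rightarrow> bool"
where
  "imex_mri_sr s n \<Omega> \<Gamma> c \<longleftrightarrow>
     1 \<le> s \<and> 1 \<le> n \<and>
     (\<forall>k<n. \<forall>i\<in>{1..s}. \<forall>j\<in>{1..s}. i \<le> j \<longrightarrow> \<Omega> k i j = 0) \<and>
     (\<forall>i\<in>{1..s}. \<forall>j\<in>{1..s}. i < j \<longrightarrow> \<Gamma> i j = 0) \<and>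
     (\<forall>j\<in>{1..s}. \<Gamma> 1 j = 0) \<and>
     c 1 = 0 \<and> (\<forall>i\<in>{2..s}. c i \<noteq> 0)"

definition omega :: "nat \<Rightarrow> (nat \<Rightarrow> nat \<Rightarrow> nat \<Rightarrow> real) \<Rightarrow> nat \<Rightarrow> nat \<Rightarrow> real \<Rightarrow> real" where
  "omega n \<Omega> i j \<tau> = (\<Sum>k<n. \<Omega> k i j * \<tau> ^ k)"

definition Omega_bar :: "nat \<Rightarrow> (nat \<Rightarrow> nat \<Rightarrow> nat \<Rightarrow> real) \<Rightarrow> nat \<Rightarrow> nat \<Rightarrow> real" where
  "Omega_bar n \<Omega> i j = (\<Sum>k<n. 1 / (real k + 1) * \<Omega> k i j)"

definition Omega_bar_Gamma ::
  "nat \<Rightarrow> (nat \<Rightarrow> nat \<Rightarrow> nat \<Rightarrow> real) \<Rightarrow> (nat \<Rightarrow> nat \<Rightarrow> real) \<Rightarrow> nat \<Rightarrow> nat \<Rightarrow> real" where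
  "Omega_bar_Gamma n \<Omega> \<Gamma> i j = Omega_bar n \<Omega> i j + \<Gamma> i j"

text \<open>
  Right-hand side of the fast problem for \<open>v\<^sub>i\<close>, in the time variable \<open>\<theta>\<close> that runs
  from \<open>0\<close> to \<open>c\<^sub>i H\<close>.
\<close>

definition fast_rhs ::
  "nat \<Rightarrow> (nat \<Rightarrow> nat \<Rightarrow> nat \<Rightarrow> real) \<Rightarrow> (nat \<Rightarrow> real) \<Rightarrow> ('d::finite) rhs \<Rightarrow> 'd rhs \<Rightarrow> 'd rhs
     \<Rightarrow> real \<Rightarrow> real \<Rightarrow> (nat \<Rightarrow> real ^ 'd) \<Rightarrow> nat \<Rightarrow> 'd rhs"
where
  "fast_rhs n \<Omega> c fF fI fE t H Y i = (\<lambda>\<theta> v.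
     fF (t + \<theta>) v + (1 / c i) *\<^sub>R (\<Sum>j=1..<i. omega n \<Omega> i j (\<theta> / (c i * H)) *\<^sub>R
       (fE (t + c j * H) (Y j) + fI (t + c j * H) (Y j))))"

text \<open>
  \<open>Y\<close> are the slow stages and \<open>V i\<close> the fast stages of the single Runge-Kutta step of size \<open>c\<^sub>i H\<close>
  that replaces the exact solution of the fast problem for \<open>v\<^sub>i\<close>.
\<close>

definition mri_stages ::
  "nat \<Rightarrow> nat \<Rightarrow> (nat \<Rightarrow> nat \<Rightarrow> nat \<Rightarrow> real) \<Rightarrow> (nat \<Rightarrow> nat \<Rightarrow> real) \<Rightarrow> (nat \<Rightarrow> real)
     \<Rightarrow> nat \<Rightarrow> (nat \<Rightarrow> nat \<Rightarrow> real) \<Rightarrow> (nat \<Rightarrow> real)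
     \<Rightarrow> ('d::finite) rhs \<Rightarrow> 'd rhs \<Rightarrow> 'd rhs \<Rightarrow> real \<Rightarrow> real ^ 'd \<Rightarrow> real
     \<Rightarrow> (nat \<Rightarrow> nat \<Rightarrow> real ^ 'd) \<Rightarrow> (nat \<Rightarrow> real ^ 'd) \<Rightarrow> bool"
where
  "mri_stages s n \<Omega> \<Gamma> c sF A b fF fI fE t y H V Y \<longleftrightarrow>
     Y 1 = y \<and>
     (\<forall>i\<in>{2..s}.
        rk_stages sF A (fast_rhs n \<Omega> c fF fI fE t H Y i) 0 y (c i * H) (V i) \<and>
        Y i = rk_result sF A b (fast_rhs n \<Omega> c fF fI fE t H Y i) 0 y (c i * H) (V i)
              + H *\<^sub>R (\<Sum>j=1..i. \<Gamma> i j *\<^sub>R fI (t + c j * H) (Y j)))"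

definition mri_step ::
  "nat \<Rightarrow> nat \<Rightarrow> (nat \<Rightarrow> nat \<Rightarrow> nat \<Rightarrow> real) \<Rightarrow> (nat \<Rightarrow> nat \<Rightarrow> real) \<Rightarrow> (nat \<Rightarrow> real)
     \<Rightarrow> nat \<Rightarrow> (nat \<Rightarrow> nat \<Rightarrow> real) \<Rightarrow> (nat \<Rightarrow> real)
     \<Rightarrow> ('d::finite) rhs \<Rightarrow> 'd rhs \<Rightarrow> 'd rhs \<Rightarrow> real \<Rightarrow> real ^ 'd \<Rightarrow> real \<Rightarrow> real \<Rightarrow> real ^ 'd \<Rightarrow> bool"
where
  "mri_step s n \<Omega> \<Gamma> c sF A b fF fI fE t y r H y1 \<longleftrightarrow>
     (\<exists>V Y. mri_stages s n \<Omega> \<Gamma> c sF A b fF fI fE t y H V Y \<and>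
            (\<forall>i\<in>{1..s}. norm (Y i - y) \<le> r) \<and>
            (\<forall>i\<in>{2..s}. \<forall>j\<in>{1..sF}. norm (V i j - y) \<le> r) \<and>
            y1 = Y s)"

definition mri_accurate ::
  "('d::finite) itself \<Rightarrow> nat \<Rightarrow> nat \<Rightarrow> (nat \<Rightarrow> nat \<Rightarrow> nat \<Rightarrow> real) \<Rightarrow> (nat \<Rightarrow> nat \<Rightarrow> real)
     \<Rightarrow> (nat \<Rightarrow> real) \<Rightarrow> nat \<Rightarrow> (nat \<Rightarrow> nat \<Rightarrow> real) \<Rightarrow> (nat \<Rightarrow> real) \<Rightarrow> nat \<Rightarrow> bool"
where
  "mri_accurate TYPE('d) s n \<Omega> \<Gamma> c sF A b p \<longleftrightarrow>
     (\<exists>m. \<forall>(fF :: 'd rhs) fI fE t0 T y.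
        smooth_rhs m fF \<longrightarrow> smooth_rhs m fI \<longrightarrow> smooth_rhs m fE \<longrightarrow>
        exact_solution (\<lambda>t x. fF t x + fI t x + fE t x) t0 T y \<longrightarrow>
        local_error_order p y t0 (mri_step s n \<Omega> \<Gamma> c sF A b fF fI fE t0 (y t0)))"

section \<open>GARK tableaux, internal consistency, slow base method\<close>

text \<open>
  The Kronecker factor \<open>A c\<^sup>k\<close> is a column and \<open>b\<^sup>T\<close> is a row, so the trivial index of that factor
  is dropped. A fast index is a pair \<open>(i, j)\<close> of a slow stage \<open>i\<close> and a fast stage \<open>j\<close>. The
  matrices for \<open>F,E\<close> and \<open>F,I\<close> are equal.
\<close>

definition gark_FF ::
  "(nat \<Rightarrow> real) \<Rightarrow> (nat \<Rightarrow> nat \<Rightarrow> real) \<Rightarrow> nat \<times> nat \<Rightarrow> nat \<times> nat \<Rightarrow> real" where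
  "gark_FF c A = (\<lambda>(i, j) (k, l). (if i = k then c i else 0) * A j l)"

definition gark_FE ::
  "nat \<Rightarrow> (nat \<Rightarrow> nat \<Rightarrow> nat \<Rightarrow> real) \<Rightarrow> nat \<Rightarrow> (nat \<Rightarrow> nat \<Rightarrow> real) \<Rightarrow> nat \<times> nat \<Rightarrow> nat \<Rightarrow> real" where
  "gark_FE n \<Omega> sF A = (\<lambda>(i, j) l. \<Sum>k<n. \<Omega> k i l * (\<Sum>q=1..sF. A j q * abscissae sF A q ^ k))"

abbreviation gark_FI ::
  "nat \<Rightarrow> (nat \<Rightarrow> nat \<Rightarrow> nat \<Rightarrow> real) \<Rightarrow> nat \<Rightarrow> (nat \<Rightarrow> nat \<Rightarrow> real) \<Rightarrow> nat \<times> nat \<Rightarrow> nat \<Rightarrow> real" where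
  "gark_FI \<equiv> gark_FE"

definition gark_SF ::
  "(nat \<Rightarrow> real) \<Rightarrow> (nat \<Rightarrow> real) \<Rightarrow> nat \<Rightarrow> nat \<times> nat \<Rightarrow> real" where
  "gark_SF c b = (\<lambda>i (k, l). (if i = k then c i else 0) * b l)"

abbreviation gark_SE :: "nat \<Rightarrow> (nat \<Rightarrow> nat \<Rightarrow> nat \<Rightarrow> real) \<Rightarrow> nat \<Rightarrow> nat \<Rightarrow> real" where
  "gark_SE \<equiv> Omega_bar"

abbreviation gark_SI ::
  "nat \<Rightarrow> (nat \<Rightarrow> nat \<Rightarrow> nat \<Rightarrow> real) \<Rightarrow> (nat \<Rightarrow> nat \<Rightarrow> real) \<Rightarrow> nat \<Rightarrow> nat \<Rightarrow> real" where
  "gark_SI \<equiv> Omega_bar_Gamma"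

definition internally_consistent ::
  "nat \<Rightarrow> nat \<Rightarrow> (nat \<Rightarrow> nat \<Rightarrow> nat \<Rightarrow> real) \<Rightarrow> (nat \<Rightarrow> nat \<Rightarrow> real) \<Rightarrow> (nat \<Rightarrow> real)
     \<Rightarrow> nat \<Rightarrow> (nat \<Rightarrow> nat \<Rightarrow> real) \<Rightarrow> (nat \<Rightarrow> real) \<Rightarrow> bool"
where
  "internally_consistent s n \<Omega> \<Gamma> c sF A b \<longleftrightarrow>
     (\<forall>x\<in>{1..s} \<times> {1..sF}.
        row_sum ({1..s} \<times> {1..sF}) (gark_FF c A) x = row_sum {1..s} (gark_FE n \<Omega> sF A) x \<and>
        row_sum {1..s} (gark_FE n \<Omega> sF A) x = row_sum {1..s} (gark_FI n \<Omega> sF A) x) \<and>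
     (\<forall>i\<in>{1..s}.
        row_sum ({1..s} \<times> {1..sF}) (gark_SF c b) i = row_sum {1..s} (gark_SE n \<Omega>) i \<and>
        row_sum {1..s} (gark_SE n \<Omega>) i = row_sum {1..s} (gark_SI n \<Omega> \<Gamma>) i \<and>
        row_sum {1..s} (gark_SI n \<Omega> \<Gamma>) i = c i)"

definition slow_base_accurate ::
  "('d::finite) itself \<Rightarrow> nat \<Rightarrow> nat \<Rightarrow> (nat \<Rightarrow> nat \<Rightarrow> nat \<Rightarrow> real) \<Rightarrow> (nat \<Rightarrow> nat \<Rightarrow> real) \<Rightarrow> nat \<Rightarrow> bool"
where
  "slow_base_accurate TYPE('d) s n \<Omega> \<Gamma> p \<longleftrightarrow>
     ark_accurate TYPE('d) s (Omega_bar n \<Omega>) (Omega_bar n \<Omega> s)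
       (Omega_bar_Gamma n \<Omega> \<Gamma>) (Omega_bar_Gamma n \<Omega> \<Gamma> s) p"

end

theory Submission
  imports Defs
begin

text \<open>
  Stacking the slow stages \<open>Y\<^sub>i\<close> and the fast stages \<open>V\<^sub>i\<^sub>,\<^sub>j\<close> turns one step of the method into
  one step of an additive Runge-Kutta method whose three tableaux (fast, implicit, explicit) act on
  common stages with common abscissae; internal consistency says exactly that each tableau has these
  abscissae as row sums. For such a method, order three follows from the conditions
  \<open>\<Sum>\<beta> = 1\<close>, \<open>\<Sum>\<beta>C = 1/2\<close>, \<open>\<Sum>\<beta>C\<^sup>2 = 1/3\<close>, and \<open>\<Sum>\<beta>\<^sup>\<sigma>\<alpha>\<^sup>\<nu>C = 1/6\<close> for all pairs of colours, by
  comparing Taylor expansions. Conversely, test problems show that accuracy of order \<open>p\<close> forces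
  \<open>\<Sum>\<beta>C\<^sup>k = 1/(k+1)\<close> for \<open>k < p\<close> and \<open>\<Sum>\<beta>\<^sup>\<sigma>\<alpha>\<^sup>\<nu>C\<^sup>k = 1/((k+1)(k+2))\<close> for \<open>k + 2 \<le> p\<close>. Applied to the
  slow base method and to the fast method this gives every condition; only the pair (fast, slow) needs
  the extra hypothesis: its coefficient is \<open>\<Sum>\<^sub>k b\<^sup>TAc\<^sup>k e\<^sup>T\<Omega>\<^sub>kc\<close> with fast \<open>b\<^sup>TAc\<^sup>k = 1/((k+1)(k+2))\<close>, which
  is where the order \<open>n + 1\<close> of the fast method enters.
\<close>

section \<open>Powers of the step size as error bounds\<close>

text \<open>Implicit stage equations may have several solutions near the initial value, so every
  error bound must be uniform over all of them. For this reason \<open>bigo_pow\<close> takes an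
  arbitrary filter and an arbitrary step-size function \<open>h\<close>: one calculus covers time
  tending to 0 along a solution, a scaled step \<open>\<theta> * h\<close> that may vanish or be
  negative, and pairs of a step with a stage solution. Accuracy is given analytically and in one
  fixed dimension, so independence of elementary differentials cannot be invoked to obtain order
  conditions. The test problems instead have solutions along a single vector, and a condition is
  read off as the coefficient of a power of the step that is too low for the error bound. Stages
  usually match the exact solution only to first order. Their quadratic defect is a combination of
  the terms \<open>\<alpha>C - C^2/2\<close>, one per colour, and the third-order conditions say
  that the weights annihilate it. For the pair (slow, fast) this is automatic, since the fast
  quadrature already gives each slow stage the value \<open>c^2/2\<close>.\<close>

definition bigo_pow :: "'x filter \<Rightarrow> ('x \<Rightarrow> real) \<Rightarrow> nat \<Rightarrow> ('x \<Rightarrow> 'a::real_normed_vector) \<Rightarrow> bool"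
  where "bigo_pow F h k g \<longleftrightarrow> (\<exists>C. eventually (\<lambda>x. norm (g x) \<le> C * \<bar>h x\<bar> ^ k) F)"

lemma bigo_powI: "eventually (\<lambda>x. norm (g x) \<le> C * \<bar>h x\<bar> ^ k) F \<Longrightarrow> bigo_pow F h k g"
  by (auto simp: bigo_pow_def)

lemma bigo_powE:
  assumes "bigo_pow F h k g"
  obtains C where "C \<ge> 0" "eventually (\<lambda>x. norm (g x) \<le> C * \<bar>h x\<bar> ^ k) F"
proof -
  obtain C where C: "eventually (\<lambda>x. norm (g x) \<le> C * \<bar>h x\<bar> ^ k) F"
    using assms by (auto simp: bigo_pow_def)
  have "eventually (\<lambda>x. norm (g x) \<le> \<bar>C\<bar> * \<bar>h x\<bar> ^ k) F"
    using C
  proof eventually_elim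
    case (elim x)
    have "C * \<bar>h x\<bar> ^ k \<le> \<bar>C\<bar> * \<bar>h x\<bar> ^ k" by (intro mult_right_mono) auto
    then show ?case using elim by linarith
  qed
  then show thesis using that[of "\<bar>C\<bar>"] by simp
qed

lemma bigo_pow_cong:
  assumes "bigo_pow F h k g" "eventually (\<lambda>x. g x = g' x) F"
  shows "bigo_pow F h k g'"
proof -
  obtain C where C: "eventually (\<lambda>x. norm (g x) \<le> C * \<bar>h x\<bar> ^ k) F"
    using assms by (auto simp: bigo_pow_def)
  show ?thesis
    by (rule bigo_powI[of _ C]) (use C assms(2) in eventually_elim, simp)
qed

lemma bigo_pow_eq:
  assumes "bigo_pow F h k g" "\<And>x. g x = g' x"
  shows "bigo_pow F h k g'"
  using bigo_pow_cong[OF assms(1)] assms(2) by simp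

lemma bigo_pow_mono:
  assumes "bigo_pow F h j g" "(h \<longlongrightarrow> 0) F" "k \<le> j"
  shows "bigo_pow F h k g"
proof -
  obtain C where C: "C \<ge> 0" "eventually (\<lambda>x. norm (g x) \<le> C * \<bar>h x\<bar> ^ j) F"
    using bigo_powE[OF assms(1)] by blast
  have "eventually (\<lambda>x. \<bar>h x\<bar> < 1) F"
    using tendstoD[OF assms(2), of 1] by (simp add: dist_real_def)
  with C(2) have "eventually (\<lambda>x. norm (g x) \<le> C * \<bar>h x\<bar> ^ k) F"
  proof eventually_elim
    case (elim x)
    have "\<bar>h x\<bar> ^ j \<le> \<bar>h x\<bar> ^ k" using elim assms(3) by (intro power_decreasing) auto
    then have "C * \<bar>h x\<bar> ^ j \<le> C * \<bar>h x\<bar> ^ k" using C(1) by (rule mult_left_mono)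
    then show ?case using elim by linarith
  qed
  then show ?thesis by (rule bigo_powI)
qed

lemma bigo_pow_zero: "bigo_pow F h k (\<lambda>x. 0)"
  by (rule bigo_powI[of _ 0]) simp

lemma bigo_pow_add:
  assumes "bigo_pow F h k g1" "bigo_pow F h k g2"
  shows "bigo_pow F h k (\<lambda>x. g1 x + g2 x)"
proof -
  obtain C D where C: "eventually (\<lambda>x. norm (g1 x) \<le> C * \<bar>h x\<bar> ^ k) F"
    and D: "eventually (\<lambda>x. norm (g2 x) \<le> D * \<bar>h x\<bar> ^ k) F"
    using assms by (auto simp: bigo_pow_def)
  show ?thesis
    by (rule bigo_powI[of _ "C + D"])
       (use C D in \<open>eventually_elim, auto simp: algebra_simps intro: norm_triangle_le\<close>)
qed

lemma bigo_pow_bounded_linear: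
  assumes "bounded_linear D" "bigo_pow F h k g"
  shows "bigo_pow F h k (\<lambda>x. D (g x))"
proof -
  obtain C where C: "eventually (\<lambda>x. norm (g x) \<le> C * \<bar>h x\<bar> ^ k) F"
    using assms by (auto simp: bigo_pow_def)
  obtain B where B: "B \<ge> 0" "\<And>x. norm (D x) \<le> norm x * B"
    using bounded_linear.nonneg_bounded[OF assms(1)] by blast
  show ?thesis
  proof (rule bigo_powI[of _ "B * C"], use C in eventually_elim)
    case (elim x)
    have "norm (g x) * B \<le> (C * \<bar>h x\<bar> ^ k) * B" using elim B(1) by (rule mult_right_mono)
    then show ?case using B(2)[of "g x"] by (simp add: mult_ac)
  qed
qed

lemma bigo_pow_scaleR: "bigo_pow F h k g \<Longrightarrow> bigo_pow F h k (\<lambda>x. c *\<^sub>R g x)"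
  by (rule bigo_pow_bounded_linear[OF bounded_linear_scaleR_right])

lemma bigo_pow_diff:
  assumes "bigo_pow F h k g1" "bigo_pow F h k g2"
  shows "bigo_pow F h k (\<lambda>x. g1 x - g2 x)"
  using bigo_pow_add[OF assms(1) bigo_pow_scaleR[OF assms(2), of "-1"]] by simp

lemma bigo_pow_sum:
  assumes "\<And>i. i \<in> I \<Longrightarrow> bigo_pow F h k (g i)"
  shows "bigo_pow F h k (\<lambda>x. \<Sum>i\<in>I. g i x)"
  using assms
  by (induction I rule: infinite_finite_induct) (auto intro: bigo_pow_zero bigo_pow_add)

lemma bigo_pow_times:
  assumes "bigo_pow F h k g"
  shows "bigo_pow F h (Suc k) (\<lambda>x. h x *\<^sub>R g x)"
proof -
  obtain C where C: "eventually (\<lambda>x. norm (g x) \<le> C * \<bar>h x\<bar> ^ k) F"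
    using assms by (auto simp: bigo_pow_def)
  show ?thesis
  proof (rule bigo_powI[of _ C], use C in eventually_elim)
    case (elim x)
    show ?case using mult_left_mono[OF elim, of "\<bar>h x\<bar>"] by (simp add: mult_ac)
  qed
qed

lemma bigo_pow_power: "bigo_pow F h k (\<lambda>x. h x ^ k *\<^sub>R v)"
  by (rule bigo_powI[of _ "norm v"]) (simp add: power_abs mult.commute)

lemma bigo_pow_rescale:
  assumes "bigo_pow F (\<lambda>x. c * h x) k g"
  shows "bigo_pow F h k g"
proof -
  obtain C where C: "eventually (\<lambda>x. norm (g x) \<le> C * \<bar>c * h x\<bar> ^ k) F"
    using assms by (auto simp: bigo_pow_def)
  show ?thesis
    by (rule bigo_powI[of _ "C * \<bar>c\<bar> ^ k"])
       (use C in \<open>simp add: abs_mult power_mult_distrib mult_ac\<close>)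
qed

lemma bigo_pow_compose:
  assumes "bigo_pow F h k g" "filterlim u F G"
  shows "bigo_pow G (\<lambda>x. h (u x)) k (\<lambda>x. g (u x))"
proof -
  obtain C where C: "eventually (\<lambda>x. norm (g x) \<le> C * \<bar>h x\<bar> ^ k) F"
    using assms by (auto simp: bigo_pow_def)
  then show ?thesis
    using assms(2) by (auto simp: bigo_pow_def filterlim_iff)
qed

lemma bigo_pow_tendsto:
  assumes "bigo_pow F h (Suc k) g" "(h \<longlongrightarrow> 0) F"
  shows "(g \<longlongrightarrow> 0) F"
proof -
  have "bigo_pow F h 1 g" using assms by (rule bigo_pow_mono) simp
  then obtain C where C: "eventually (\<lambda>x. norm (g x) \<le> C * \<bar>h x\<bar>) F"
    by (auto simp: bigo_pow_def)
  have "((\<lambda>x. C * \<bar>h x\<bar>) \<longlongrightarrow> 0) F"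
    using assms(2) by (auto intro!: tendsto_eq_intros)
  then show ?thesis
    using C by (rule Lim_null_comparison[rotated])
qed

text \<open>This turns error bounds into algebraic identities. Dividing by
  \<open>\<bar>h x\<bar> ^ k\<close> leaves the fixed number \<open>norm v\<close> below a quantity
  tending to 0; on the trivial filter this would say nothing, hence
  \<open>F \<noteq> bot\<close>.\<close>

lemma bigo_pow_const_unique:
  assumes "bigo_pow F h (Suc k) (\<lambda>x. h x ^ k *\<^sub>R v)" "(h \<longlongrightarrow> 0) F"
    "eventually (\<lambda>x. h x \<noteq> 0) F" "F \<noteq> bot"
  shows "v = 0"
proof -
  obtain C where C: "eventually (\<lambda>x. norm (h x ^ k *\<^sub>R v) \<le> C * \<bar>h x\<bar> ^ Suc k) F"
    using assms by (auto simp: bigo_pow_def)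
  have "eventually (\<lambda>x. norm v \<le> C * \<bar>h x\<bar>) F"
    using C assms(3)
  proof eventually_elim
    case (elim x)
    then have "\<bar>h x\<bar> ^ k * norm v \<le> \<bar>h x\<bar> ^ k * (C * \<bar>h x\<bar>)"
      by (simp add: power_abs mult_ac)
    then show ?case using elim(2) by simp
  qed
  moreover have "((\<lambda>x. C * \<bar>h x\<bar>) \<longlongrightarrow> 0) F"
    using assms(2) by (auto intro!: tendsto_eq_intros)
  ultimately have "norm v \<le> 0"
    using tendsto_lowerbound assms(4) by blast
  then show ?thesis by simp
qed

text \<open>Mean value inequality on the segment from 0 to \<open>s\<close>, where the bound on
  \<open>R'\<close> is worst at \<open>s\<close>; convexity keeps the segment in \<open>S\<close>.
  The set is \<open>UNIV\<close> for Taylor expansion along a line and \<open>{0..T}\<close> for a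
  solution known only forward in time.\<close>

lemma bigo_pow_integrate:
  fixes R :: "real \<Rightarrow> 'a::real_normed_vector"
  assumes "convex S" "0 \<in> S" "R 0 = 0"
    and deriv: "\<And>s. s \<in> S \<Longrightarrow> (R has_vector_derivative R' s) (at s within S)"
    and "bigo_pow (inf (nhds 0) (principal S)) (\<lambda>s. s) k R'"
  shows "bigo_pow (inf (nhds 0) (principal S)) (\<lambda>s. s) (Suc k) R"
proof -
  obtain C where C: "C \<ge> 0" "eventually (\<lambda>s. norm (R' s) \<le> C * \<bar>s\<bar> ^ k) (inf (nhds 0) (principal S))"
    using bigo_powE[OF assms(5)] by blast
  then obtain e where e: "e > 0" "\<And>s. s \<in> S \<Longrightarrow> \<bar>s\<bar> < e \<Longrightarrow> norm (R' s) \<le> C * \<bar>s\<bar> ^ k"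
    by (auto simp: eventually_inf_principal eventually_nhds_metric dist_real_def)
  have "norm (R s) \<le> C * \<bar>s\<bar> ^ Suc k" if s: "s \<in> S" "\<bar>s\<bar> < e" for s
  proof -
    have sub: "closed_segment 0 s \<subseteq> S"
      using assms(1,2) s(1) by (simp add: closed_segment_subset)
    have small: "\<bar>u\<bar> \<le> \<bar>s\<bar>" if "u \<in> closed_segment 0 s" for u
      using that by (auto simp: closed_segment_eq_real_ivl split: if_splits)
    have "norm (R s - R 0) \<le> (C * \<bar>s\<bar> ^ k) * norm (s - 0)"
    proof (rule differentiable_bound[OF convex_closed_segment])
      fix u assume u: "u \<in> closed_segment 0 s"
      show "(R has_derivative (\<lambda>x. x *\<^sub>R R' u)) (at u within closed_segment 0 s)"
        using has_derivative_subset[OF deriv[unfolded has_vector_derivative_def] sub] u sub by blast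
      have "norm (R' u) \<le> C * \<bar>u\<bar> ^ k" using u sub small[OF u] s by (intro e(2)) auto
      also have "\<dots> \<le> C * \<bar>s\<bar> ^ k"
        using small[OF u] C(1) by (intro mult_left_mono power_mono) auto
      finally show "onorm (\<lambda>x. x *\<^sub>R R' u) \<le> C * \<bar>s\<bar> ^ k"
        using C(1) by (intro onorm_le) (auto simp: mult.commute mult_left_mono)
    qed auto
    then show ?thesis using assms(3) by (simp add: mult_ac)
  qed
  then show ?thesis
    using e(1)
    by (intro bigo_powI[of _ C])
       (auto simp: eventually_inf_principal eventually_nhds_metric dist_real_def)
qed

section \<open>Taylor estimates for functions of class \<open>C\<^sup>m\<close>\<close>

lemma Cm_Suc_imp_Cm: "Cm (Suc m) f \<Longrightarrow> Cm m f"
proof (induction m arbitrary: f)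
  case 0
  then show ?case
    by (simp add: continuous_at_imp_continuous_on differentiable_imp_continuous_within)
next
  case (Suc m)
  have "Cm m (\<lambda>x. frechet_derivative f (at x) v)" for v
    using Suc.prems by (intro Suc.IH) (subst (asm) Cm.simps, blast)
  then show ?case using Suc.prems by (simp only: Cm.simps) blast
qed

lemma Cm_le: "Cm m f \<Longrightarrow> k \<le> m \<Longrightarrow> Cm k f"
  by (induction m) (auto simp: le_Suc_eq dest: Cm_Suc_imp_Cm simp del: Cm.simps)

lemma Cm_has_derivative:
  "Cm (Suc m) f \<Longrightarrow> (f has_derivative frechet_derivative f (at x)) (at x)"
  by (metis Cm.simps(2) frechet_derivative_works)

text \<open>\<open>Cm\<close> controls derivatives one direction at a time. This recovers an
  operator norm bound from the finitely many basis directions.\<close>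

lemma norm_linear_le_Basis:
  fixes D :: "'a::euclidean_space \<Rightarrow> 'b::real_normed_vector"
  assumes "linear D"
  shows "norm (D v) \<le> (\<Sum>b\<in>Basis. norm (D b)) * norm v"
proof -
  have "D v = D (\<Sum>b\<in>Basis. (v \<bullet> b) *\<^sub>R b)" by (simp add: euclidean_representation)
  also have "\<dots> = (\<Sum>b\<in>Basis. (v \<bullet> b) *\<^sub>R D b)"
    by (simp add: linear_sum[OF assms] linear_cmul[OF assms])
  also have "norm \<dots> \<le> (\<Sum>b\<in>Basis. norm (D b) * norm v)"
    by (rule order_trans[OF norm_sum])
       (auto intro!: sum_mono mult_left_mono simp: mult.commute[of "\<bar>_\<bar>"] Basis_le_norm)
  finally show ?thesis by (simp add: sum_distrib_right)
qed

text \<open>The derivatives in basis directions are continuous, hence bounded on the compact unit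
  ball, and the mean value inequality applies.\<close>

lemma Cm_lipschitz:
  fixes g :: "'a::euclidean_space \<Rightarrow> 'b::euclidean_space"
  assumes "Cm 1 g"
  obtains L where "L \<ge> 0"
    "\<And>u w. u \<in> cball p 1 \<Longrightarrow> w \<in> cball p 1 \<Longrightarrow> norm (g u - g w) \<le> L * norm (u - w)"
proof -
  have Cm: "Cm (Suc 0) g" using assms by simp
  have "continuous_on (cball p 1) (\<lambda>x. \<Sum>b\<in>Basis. norm (frechet_derivative g (at x) b))"
    using Cm by (intro continuous_on_sum continuous_on_norm)
                (auto intro: continuous_on_subset)
  then have "bounded ((\<lambda>x. \<Sum>b\<in>Basis. norm (frechet_derivative g (at x) b)) ` cball p 1)"
    by (intro compact_imp_bounded compact_continuous_image) auto
  then obtain L where L: "L > 0"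
    "\<And>x. x \<in> cball p 1 \<Longrightarrow> (\<Sum>b\<in>Basis. norm (frechet_derivative g (at x) b)) \<le> L"
    by (force simp: bounded_pos)
  show thesis
  proof (rule that)
    show "L \<ge> 0" using L(1) by simp
    fix u w assume uw: "u \<in> cball p 1" "w \<in> cball p 1"
    show "norm (g u - g w) \<le> L * norm (u - w)"
    proof (rule differentiable_bound[of "cball p 1" g "\<lambda>x. frechet_derivative g (at x)"])
      fix x assume x: "x \<in> cball p 1"
      show "(g has_derivative frechet_derivative g (at x)) (at x within cball p 1)"
        using Cm_has_derivative[OF Cm] by (rule has_derivative_at_withinI)
      have lin: "linear (frechet_derivative g (at x))"
        using Cm_has_derivative[OF Cm] by (rule has_derivative_linear)
      show "onorm (frechet_derivative g (at x)) \<le> L"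
        by (rule onorm_le)
           (rule order_trans[OF norm_linear_le_Basis[OF lin]], use L(2)[OF x] in \<open>simp add: mult_right_mono\<close>)
    qed (use uw in auto)
  qed
qed

text \<open>On a ball of radius \<open>\<rho>\<close> the derivative differs from the one at
  \<open>p\<close> by at most a multiple of \<open>\<rho>\<close>, so the mean value inequality
  applies to \<open>g\<close> minus its linear part at \<open>p\<close>. Linearizing at the centre,
  not at \<open>w\<close>, yields one Jacobian for all stages.\<close>

lemma Cm_linearization:
  fixes g :: "'a::euclidean_space \<Rightarrow> 'b::euclidean_space"
  assumes "Cm 2 g"
  obtains L where "L \<ge> 0"
    "\<And>u w \<rho>. \<rho> \<le> 1 \<Longrightarrow> u \<in> cball p \<rho> \<Longrightarrow> w \<in> cball p \<rho> \<Longrightarrow>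
       norm (g u - g w - frechet_derivative g (at p) (u - w)) \<le> L * \<rho> * norm (u - w)"
proof -
  have Cm: "Cm (Suc (Suc 0)) g" using assms by (simp add: numeral_2_eq_2)
  let ?g = "\<lambda>x. frechet_derivative g (at x)"
  have D: "(g has_derivative ?g x) (at x)" for x using Cm by (rule Cm_has_derivative)
  have lin: "linear (?g x)" for x using D by (rule has_derivative_linear)
  have "\<exists>L. L \<ge> 0 \<and> (\<forall>x\<in>cball p 1. norm (?g x b - ?g p b) \<le> L * norm (x - p))" for b
  proof -
    have "Cm 1 (\<lambda>x. ?g x b)" using Cm by simp
    then show ?thesis
      by (rule Cm_lipschitz[where p = p]) (metis centre_in_cball zero_le_one)
  qed
  then obtain L where L: "\<And>b. L b \<ge> 0"
    "\<And>b x. x \<in> cball p 1 \<Longrightarrow> norm (?g x b - ?g p b) \<le> L b * norm (x - p)"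
    by metis
  let ?L = "\<Sum>b\<in>Basis. L b"
  have "norm (g u - g w - ?g p (u - w)) \<le> ?L * \<rho> * norm (u - w)"
    if \<rho>: "\<rho> \<le> 1" and uw: "u \<in> cball p \<rho>" "w \<in> cball p \<rho>" for u w \<rho>
  proof -
    have "norm ((g u - ?g p u) - (g w - ?g p w)) \<le> (?L * \<rho>) * norm (u - w)"
    proof (rule differentiable_bound[of "cball p \<rho>" _ "\<lambda>x v. ?g x v - ?g p v"])
      fix x assume x: "x \<in> cball p \<rho>"
      show "((\<lambda>x. g x - ?g p x) has_derivative (\<lambda>v. ?g x v - ?g p v)) (at x within cball p \<rho>)"
        by (intro has_derivative_diff has_derivative_at_withinI[OF D]
              bounded_linear_imp_has_derivative has_derivative_bounded_linear[OF D])
      have lin': "linear (\<lambda>v. ?g x v - ?g p v)" using lin by (intro linear_compose_sub)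
      have "(\<Sum>b\<in>Basis. norm (?g x b - ?g p b)) \<le> (\<Sum>b\<in>Basis. L b * \<rho>)"
      proof (rule sum_mono)
        fix b :: 'a
        have "norm (?g x b - ?g p b) \<le> L b * norm (x - p)" using x \<rho> by (intro L(2)) auto
        also have "\<dots> \<le> L b * \<rho>"
          using x L(1) by (intro mult_left_mono) (auto simp: dist_norm norm_minus_commute)
        finally show "norm (?g x b - ?g p b) \<le> L b * \<rho>" .
      qed
      then show "onorm (\<lambda>v. ?g x v - ?g p v) \<le> ?L * \<rho>"
        by (intro onorm_le order_trans[OF norm_linear_le_Basis[OF lin']] mult_right_mono)
           (auto simp: sum_distrib_right)
    qed (use uw in auto)
    then show ?thesis by (simp add: linear_diff[OF lin] algebra_simps)
  qed
  then show thesis using that[of ?L] L(1) by (simp add: sum_nonneg)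
qed

lemma bigo_pow_Cm_diff:
  fixes g :: "'a::euclidean_space \<Rightarrow> 'b::euclidean_space"
  assumes "Cm 1 g" "(u \<longlongrightarrow> p) F" "(w \<longlongrightarrow> p) F" "bigo_pow F h k (\<lambda>x. u x - w x)"
  shows "bigo_pow F h k (\<lambda>x. g (u x) - g (w x))"
proof -
  obtain L where L: "L \<ge> 0"
    "\<And>u w. u \<in> cball p 1 \<Longrightarrow> w \<in> cball p 1 \<Longrightarrow> norm (g u - g w) \<le> L * norm (u - w)"
    using Cm_lipschitz[OF assms(1), of p] by metis
  obtain C where C: "eventually (\<lambda>x. norm (u x - w x) \<le> C * \<bar>h x\<bar> ^ k) F"
    using assms(4) by (auto simp: bigo_pow_def)
  have "eventually (\<lambda>x. norm (g (u x) - g (w x)) \<le> (L * C) * \<bar>h x\<bar> ^ k) F"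
    using C tendstoD[OF assms(2) zero_less_one] tendstoD[OF assms(3) zero_less_one]
  proof eventually_elim
    case (elim x)
    have "norm (g (u x) - g (w x)) \<le> L * norm (u x - w x)"
      using elim by (intro L(2)) (auto simp: dist_commute)
    also have "\<dots> \<le> L * (C * \<bar>h x\<bar> ^ k)" using elim L(1) by (intro mult_left_mono)
    finally show ?case by (simp add: mult_ac)
  qed
  then show ?thesis by (rule bigo_powI)
qed

text \<open>Both points lie in a ball around \<open>p\<close> of radius proportional to
  \<open>\<bar>h x\<bar>\<close>, and that radius is the extra power gained.\<close>

lemma bigo_pow_Cm_linearization:
  fixes g :: "'a::euclidean_space \<Rightarrow> 'b::euclidean_space"
  assumes "Cm 2 g" "(h \<longlongrightarrow> 0) F"
    "bigo_pow F h 1 (\<lambda>x. u x - p)" "bigo_pow F h 1 (\<lambda>x. w x - p)"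
    "bigo_pow F h k (\<lambda>x. u x - w x)"
  shows "bigo_pow F h (Suc k) (\<lambda>x. g (u x) - g (w x) - frechet_derivative g (at p) (u x - w x))"
proof -
  obtain L where L: "L \<ge> 0"
    "\<And>u w \<rho>. \<rho> \<le> 1 \<Longrightarrow> u \<in> cball p \<rho> \<Longrightarrow> w \<in> cball p \<rho> \<Longrightarrow>
       norm (g u - g w - frechet_derivative g (at p) (u - w)) \<le> L * \<rho> * norm (u - w)"
    using Cm_linearization[OF assms(1), of p] by metis
  obtain C where C: "C \<ge> 0" "eventually (\<lambda>x. norm (u x - w x) \<le> C * \<bar>h x\<bar> ^ k) F"
    using bigo_powE[OF assms(5)] by blast
  obtain A where A: "A \<ge> 0" "eventually (\<lambda>x. norm (u x - p) \<le> A * \<bar>h x\<bar>) F"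
    using bigo_powE[OF assms(3)] by (simp only: power_one_right) blast
  obtain B where B: "B \<ge> 0" "eventually (\<lambda>x. norm (w x - p) \<le> B * \<bar>h x\<bar>) F"
    using bigo_powE[OF assms(4)] by (simp only: power_one_right) blast
  have "((\<lambda>x. (A + B) * \<bar>h x\<bar>) \<longlongrightarrow> 0) F"
    using assms(2) by (auto intro!: tendsto_eq_intros)
  then have "eventually (\<lambda>x. (A + B) * \<bar>h x\<bar> < 1) F"
    by (rule order_tendstoD) simp
  with A(2) B(2) C(2)
  have "eventually (\<lambda>x. norm (g (u x) - g (w x) - frechet_derivative g (at p) (u x - w x))
          \<le> (L * (A + B) * C) * \<bar>h x\<bar> ^ Suc k) F"
  proof eventually_elim
    case (elim x)
    let ?\<rho> = "(A + B) * \<bar>h x\<bar>"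
    have "0 \<le> A * \<bar>h x\<bar>" "0 \<le> B * \<bar>h x\<bar>" using A B by auto
    then have "norm (g (u x) - g (w x) - frechet_derivative g (at p) (u x - w x))
      \<le> L * ?\<rho> * norm (u x - w x)"
      using elim by (intro L(2)) (auto simp: dist_norm norm_minus_commute distrib_right)
    also have "\<dots> \<le> L * ?\<rho> * (C * \<bar>h x\<bar> ^ k)"
      using elim L(1) A(1) B(1) by (intro mult_left_mono) auto
    finally show ?case by (simp add: mult_ac)
  qed
  then show ?thesis by (rule bigo_powI)
qed

lemma tendsto_ident_inf_nhds: "((\<lambda>s. s) \<longlongrightarrow> a) (inf (nhds a) (principal S))"
  by (rule filterlim_mono[OF filterlim_ident order_refl inf_le1])

text \<open>Restricted to a line, \<open>g\<close> depends on one real variable with successive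
  derivatives \<open>g1\<close> and \<open>g2\<close>. Class \<open>C^3\<close> makes
  \<open>g2\<close> locally Lipschitz; integrating this first-order bound twice gives the
  third-order remainder.\<close>

lemma bigo_pow_Cm_line:
  fixes g :: "'a::euclidean_space \<Rightarrow> 'b::euclidean_space" and p v :: 'a
  assumes "Cm 3 g" "(h \<longlongrightarrow> 0) F"
  defines "g1 \<equiv> \<lambda>x. frechet_derivative g (at x) v"
  defines "g2 \<equiv> \<lambda>x. frechet_derivative g1 (at x) v"
  shows "bigo_pow F h 2 (\<lambda>x. g (p + h x *\<^sub>R v) - g p - h x *\<^sub>R g1 p)"
    and "bigo_pow F h 3 (\<lambda>x. g (p + h x *\<^sub>R v) - g p - h x *\<^sub>R g1 p - ((h x)\<^sup>2 / 2) *\<^sub>R g2 p)"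
proof -
  have Cm: "Cm (Suc (Suc (Suc 0))) g" using assms(1) by (simp add: numeral_3_eq_3)
  have Cm1: "Cm (Suc (Suc 0)) g1" using Cm by (subst (asm) Cm.simps) (simp only: g1_def)
  have Cm2: "Cm (Suc 0) g2" using Cm1 by (subst (asm) Cm.simps) (simp only: g2_def)
  let ?N = "inf (nhds 0) (principal (UNIV :: real set))"
  have line: "((\<lambda>s. f (p + s *\<^sub>R v)) has_vector_derivative frechet_derivative f (at (p + s *\<^sub>R v)) v) (at s)"
    if "Cm (Suc m) f" for f :: "'a \<Rightarrow> 'b" and m s
  proof -
    have "((\<lambda>s. p + s *\<^sub>R v) has_derivative (\<lambda>s. s *\<^sub>R v)) (at s)"
      by (auto intro!: derivative_eq_intros)
    from has_derivative_compose[OF this Cm_has_derivative[OF that]]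
    show ?thesis
      using linear_cmul[OF has_derivative_linear[OF Cm_has_derivative[OF that]]]
      by (simp add: has_vector_derivative_def)
  qed
  have d0: "((\<lambda>s. g (p + s *\<^sub>R v)) has_vector_derivative g1 (p + s *\<^sub>R v)) (at s)" for s
    unfolding g1_def by (rule line[OF Cm])
  have d1: "((\<lambda>s. g1 (p + s *\<^sub>R v)) has_vector_derivative g2 (p + s *\<^sub>R v)) (at s)" for s
    unfolding g2_def by (rule line[OF Cm1])
  have lim: "((\<lambda>s. s) \<longlongrightarrow> 0) ?N" by (rule tendsto_ident_inf_nhds)
  have "bigo_pow ?N (\<lambda>s. s) 1 (\<lambda>s. g2 (p + s *\<^sub>R v) - g2 p)"
  proof (rule bigo_pow_Cm_diff[where p = p])
    show "Cm 1 g2" using Cm2 by simp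
    show "((\<lambda>s. p + s *\<^sub>R v) \<longlongrightarrow> p) ?N"
      using lim by (auto intro!: tendsto_eq_intros)
    show "bigo_pow ?N (\<lambda>s. s) 1 (\<lambda>s. p + s *\<^sub>R v - p)"
      using bigo_pow_power[of ?N "\<lambda>s. s" 1 v] by simp
  qed simp
  then have "bigo_pow ?N (\<lambda>s. s) (Suc 1) (\<lambda>s. g1 (p + s *\<^sub>R v) - g1 p - s *\<^sub>R g2 p)"
    by (intro bigo_pow_integrate) (auto intro!: derivative_eq_intros d1)
  then have o1: "bigo_pow ?N (\<lambda>s. s) 2 (\<lambda>s. g1 (p + s *\<^sub>R v) - g1 p - s *\<^sub>R g2 p)"
    by (simp add: numeral_2_eq_2)
  have "bigo_pow ?N (\<lambda>s. s) (Suc 2)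
      (\<lambda>s. g (p + s *\<^sub>R v) - g p - s *\<^sub>R g1 p - (s\<^sup>2 / 2) *\<^sub>R g2 p)"
    using o1
    by (intro bigo_pow_integrate) (auto intro!: derivative_eq_intros d0)
  then have o3: "bigo_pow ?N (\<lambda>s. s) 3
      (\<lambda>s. g (p + s *\<^sub>R v) - g p - s *\<^sub>R g1 p - (s\<^sup>2 / 2) *\<^sub>R g2 p)"
    by (simp add: numeral_3_eq_3 numeral_2_eq_2)
  have "bigo_pow ?N (\<lambda>s. s) 2 (\<lambda>s. s\<^sup>2 *\<^sub>R ((1/2) *\<^sub>R g2 p))" by (rule bigo_pow_power)
  with o3 have o2: "bigo_pow ?N (\<lambda>s. s) 2 (\<lambda>s. g (p + s *\<^sub>R v) - g p - s *\<^sub>R g1 p)"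
    using bigo_pow_add[OF bigo_pow_mono[OF o3 lim, of 2]] by fastforce
  \<comment> \<open>The neighbourhood filter contains the point 0 itself, so \<open>h\<close> may
    vanish; this happens for a stage with abscissa 0.\<close>
  have h: "filterlim h ?N F" using assms(2) by simp
  show "bigo_pow F h 2 (\<lambda>x. g (p + h x *\<^sub>R v) - g p - h x *\<^sub>R g1 p)"
    using bigo_pow_compose[OF o2 h] .
  show "bigo_pow F h 3 (\<lambda>x. g (p + h x *\<^sub>R v) - g p - h x *\<^sub>R g1 p - ((h x)\<^sup>2 / 2) *\<^sub>R g2 p)"
    using bigo_pow_compose[OF o3 h] .
qed

lemma bigo_pow_Pair:
  assumes "bigo_pow F h k a" "bigo_pow F h k b"
  shows "bigo_pow F h k (\<lambda>x. (a x, b x))"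
proof -
  have "bounded_linear (\<lambda>a. (a, 0))" "bounded_linear (\<lambda>b. (0, b))"
    by (auto intro!: bounded_linear_Pair bounded_linear_ident bounded_linear_zero)
  from bigo_pow_add[OF bigo_pow_bounded_linear[OF this(1) assms(1)]
      bigo_pow_bounded_linear[OF this(2) assms(2)]]
  show ?thesis by simp
qed

lemma tendsto_imp_bigo_pow_0:
  assumes "(g \<longlongrightarrow> l) F"
  shows "bigo_pow F h 0 g"
proof (rule bigo_powI[of _ "norm l + 1"], use tendstoD[OF assms zero_less_one] in eventually_elim)
  case (elim x)
  then show ?case
    using norm_triangle_sub[of "g x" l] by (simp add: dist_norm)
qed

section \<open>Additive Runge-Kutta methods with common stages\<close>

text \<open>The index set \<open>K\<close> is of arbitrary type, so slow and fast stages can be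
  stacked as a disjoint sum. The abscissae are a separate parameter, which makes agreement with the
  row sums of each colour a condition to be assumed.\<close>

definition additive_stages where
  "additive_stages K S \<alpha> C f t y H Z \<longleftrightarrow>
     (\<forall>k\<in>K. Z k = y + H *\<^sub>R (\<Sum>\<sigma>\<in>S. \<Sum>l\<in>K. \<alpha> \<sigma> k l *\<^sub>R f \<sigma> (t + C l * H) (Z l)))"

definition additive_step ::
  "'k set \<Rightarrow> 'c set \<Rightarrow> ('c \<Rightarrow> 'k \<Rightarrow> 'k \<Rightarrow> real) \<Rightarrow> ('c \<Rightarrow> 'k \<Rightarrow> real) \<Rightarrow> ('k \<Rightarrow> real)
     \<Rightarrow> ('c \<Rightarrow> ('d::finite) rhs) \<Rightarrow> real \<Rightarrow> real ^ 'd \<Rightarrow> real \<Rightarrow> real \<Rightarrow> real ^ 'd \<Rightarrow> bool"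
where
  "additive_step K S \<alpha> \<beta> C f t y r H y1 \<longleftrightarrow>
     (\<exists>Z. additive_stages K S \<alpha> C f t y H Z \<and> (\<forall>k\<in>K. norm (Z k - y) \<le> r) \<and>
          y1 = y + H *\<^sub>R (\<Sum>\<sigma>\<in>S. \<Sum>l\<in>K. \<beta> \<sigma> l *\<^sub>R f \<sigma> (t + C l * H) (Z l)))"

section \<open>Taylor expansions of right-hand sides, exact solution and stages\<close>

locale smooth_additive =
  fixes S :: "'c set" and f :: "'c \<Rightarrow> ('d::finite) rhs" and t0 :: real and y0 :: "real ^ 'd"
  assumes finite_S: "finite S" and smooth: "\<And>\<sigma>. \<sigma> \<in> S \<Longrightarrow> smooth_rhs 3 (f \<sigma>)"
begin

definition g :: "'c \<Rightarrow> real \<times> (real ^ 'd) \<Rightarrow> real ^ 'd" where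
  "g \<sigma> = (\<lambda>(t, x). f \<sigma> t x)"

text \<open>\<open>G0\<close>, \<open>G1\<close>, \<open>G2\<close> are the values that the first
  three derivatives of the solution take at \<open>t0\<close>. \<open>a1\<close> and
  \<open>a2\<close> are the first two derivatives of a colour along the tangent direction
  \<open>(1, G0)\<close> in time and state, and \<open>D\<close> is its Jacobian in the
  state.\<close>

definition G0 where "G0 = (\<Sum>\<sigma>\<in>S. f \<sigma> t0 y0)"
definition a1 where "a1 \<sigma> = frechet_derivative (g \<sigma>) (at (t0, y0)) (1, G0)"
definition a2 where
  "a2 \<sigma> = frechet_derivative (\<lambda>p. frechet_derivative (g \<sigma>) (at p) (1, G0)) (at (t0, y0)) (1, G0)"
definition D where "D \<sigma> w = frechet_derivative (g \<sigma>) (at (t0, y0)) (0, w)"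
definition G1 where "G1 = (\<Sum>\<sigma>\<in>S. a1 \<sigma>)"
definition G2 where "G2 = (\<Sum>\<sigma>\<in>S. a2 \<sigma> + D \<sigma> G1)"

lemma g_Pair [simp]: "g \<sigma> (t, x) = f \<sigma> t x"
  by (simp add: g_def)

lemma Cm_g: "\<sigma> \<in> S \<Longrightarrow> m \<le> 3 \<Longrightarrow> Cm m (g \<sigma>)"
  using smooth[of \<sigma>] Cm_le unfolding smooth_rhs_def g_def by blast

lemma isCont_g: "\<sigma> \<in> S \<Longrightarrow> isCont (g \<sigma>) p"
  using Cm_g[of \<sigma> 0] by (cases p) (simp add: continuous_on_eq_continuous_at)

lemma bounded_linear_D:
  assumes "\<sigma> \<in> S"
  shows "bounded_linear (D \<sigma>)"
proof -
  have "Cm (Suc 0) (g \<sigma>)" using assms by (rule Cm_g) simp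
  then have "bounded_linear (frechet_derivative (g \<sigma>) (at (t0, y0)))"
    using Cm_has_derivative has_derivative_bounded_linear by blast
  then show ?thesis unfolding D_def
    by (rule bounded_linear_compose)
       (auto intro!: bounded_linear_Pair bounded_linear_ident bounded_linear_zero)
qed

lemma tendsto_time: "(h \<longlongrightarrow> 0) F \<Longrightarrow> ((\<lambda>x. t0 + \<theta> * h x) \<longlongrightarrow> t0) F"
  by (auto intro!: tendsto_eq_intros)

lemma bigo_pow_time: "bigo_pow F h 1 (\<lambda>x. \<theta> * h x)"
  using bigo_pow_power[of F h 1 \<theta>] by (simp add: mult.commute)

lemma rhs_expand_0:
  assumes "\<sigma> \<in> S" "(h \<longlongrightarrow> 0) F" "bigo_pow F h 1 (\<lambda>x. Z x - y0)"
  shows "bigo_pow F h 1 (\<lambda>x. f \<sigma> (t0 + \<theta> * h x) (Z x) - f \<sigma> t0 y0)"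
proof -
  have "((\<lambda>x. Z x - y0) \<longlongrightarrow> 0) F"
    by (rule bigo_pow_tendsto[OF assms(3)[unfolded One_nat_def] assms(2)])
  then have Z: "(Z \<longlongrightarrow> y0) F" by (rule LIM_zero_cancel)
  have "bigo_pow F h 1 (\<lambda>x. (t0 + \<theta> * h x, Z x) - (t0, y0))"
    using bigo_pow_Pair[OF bigo_pow_time assms(3)] by simp
  from bigo_pow_Cm_diff[OF Cm_g[OF assms(1)] tendsto_Pair[OF tendsto_time[OF assms(2)] Z]
      tendsto_const this]
  show ?thesis by simp
qed

text \<open>The base curve is the tangent line of the solution at \<open>t0\<close>, sampled at the
  scaled step \<open>\<theta> * h\<close>; the powers of \<open>\<theta>\<close> are absorbed into
  the constant.\<close>

lemma rhs_expand_line: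
  assumes "\<sigma> \<in> S" "(h \<longlongrightarrow> 0) F"
  shows "bigo_pow F h 2 (\<lambda>x. f \<sigma> (t0 + \<theta> * h x) (y0 + (\<theta> * h x) *\<^sub>R G0)
           - f \<sigma> t0 y0 - (\<theta> * h x) *\<^sub>R a1 \<sigma>)"
    and "bigo_pow F h 3 (\<lambda>x. f \<sigma> (t0 + \<theta> * h x) (y0 + (\<theta> * h x) *\<^sub>R G0)
           - f \<sigma> t0 y0 - (\<theta> * h x) *\<^sub>R a1 \<sigma> - ((\<theta> * h x)\<^sup>2 / 2) *\<^sub>R a2 \<sigma>)"
proof -
  have lim: "((\<lambda>x. \<theta> * h x) \<longlongrightarrow> 0) F" using assms(2) by (auto intro!: tendsto_eq_intros)
  have Cm: "Cm 3 (g \<sigma>)" using assms(1) by (rule Cm_g) simp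
  note line = bigo_pow_Cm_line[OF Cm lim, where p = "(t0, y0)" and v = "(1, G0)",
      folded a1_def, folded a2_def, THEN bigo_pow_rescale]
  show "bigo_pow F h 2 (\<lambda>x. f \<sigma> (t0 + \<theta> * h x) (y0 + (\<theta> * h x) *\<^sub>R G0)
           - f \<sigma> t0 y0 - (\<theta> * h x) *\<^sub>R a1 \<sigma>)"
    using line(1) by simp
  show "bigo_pow F h 3 (\<lambda>x. f \<sigma> (t0 + \<theta> * h x) (y0 + (\<theta> * h x) *\<^sub>R G0)
           - f \<sigma> t0 y0 - (\<theta> * h x) *\<^sub>R a1 \<sigma> - ((\<theta> * h x)\<^sup>2 / 2) *\<^sub>R a2 \<sigma>)"
    using line(2) by simp
qed

lemma bigo_pow_line: "bigo_pow F h 1 (\<lambda>x. (\<theta> * h x) *\<^sub>R v)"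
  using bigo_pow_power[of F h 1 "\<theta> *\<^sub>R v"] by (simp add: mult.commute)

lemma tendsto_line: "(h \<longlongrightarrow> 0) F \<Longrightarrow> ((\<lambda>x. y0 + (\<theta> * h x) *\<^sub>R G0) \<longlongrightarrow> y0) F"
  by (auto intro!: tendsto_eq_intros)

lemma rhs_expand_1:
  assumes "\<sigma> \<in> S" "(h \<longlongrightarrow> 0) F" "bigo_pow F h 2 (\<lambda>x. Z x - (y0 + (\<theta> * h x) *\<^sub>R G0))"
  shows "bigo_pow F h 2 (\<lambda>x. f \<sigma> (t0 + \<theta> * h x) (Z x) - f \<sigma> t0 y0 - (\<theta> * h x) *\<^sub>R a1 \<sigma>)"
proof -
  have "((\<lambda>x. Z x - (y0 + (\<theta> * h x) *\<^sub>R G0)) \<longlongrightarrow> 0) F"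
    by (rule bigo_pow_tendsto[OF assms(3)[unfolded numeral_2_eq_2] assms(2)])
  from tendsto_add[OF this tendsto_line[OF assms(2), of \<theta>]] have Z: "(Z \<longlongrightarrow> y0) F" by simp
  have "bigo_pow F h 2 (\<lambda>x. (t0 + \<theta> * h x, Z x) - (t0 + \<theta> * h x, y0 + (\<theta> * h x) *\<^sub>R G0))"
    using bigo_pow_Pair[OF bigo_pow_zero assms(3)] by simp
  from bigo_pow_add[OF bigo_pow_Cm_diff[OF Cm_g[OF assms(1)]
        tendsto_Pair[OF tendsto_time[OF assms(2)] Z]
        tendsto_Pair[OF tendsto_time[OF assms(2)] tendsto_line[OF assms(2)]] this]
      rhs_expand_line(1)[OF assms(1,2), of \<theta>]]
  show ?thesis by (simp add: algebra_simps)
qed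

text \<open>Here \<open>e\<close> is the quadratic defect of a stage against the exact solution.
  Since \<open>Z\<close> leaves the tangent line only at order \<open>h^2\<close>, that deviation
  enters linearly, through \<open>D\<close>, up to \<open>O(h^3)\<close>.\<close>

lemma rhs_expand_2:
  assumes "\<sigma> \<in> S" "(h \<longlongrightarrow> 0) F"
    "bigo_pow F h 3 (\<lambda>x. Z x - (y0 + (\<theta> * h x) *\<^sub>R G0 + ((\<theta> * h x)\<^sup>2 / 2) *\<^sub>R G1 + (h x)\<^sup>2 *\<^sub>R e))"
  shows "bigo_pow F h 3 (\<lambda>x. f \<sigma> (t0 + \<theta> * h x) (Z x) -
     (f \<sigma> t0 y0 + (\<theta> * h x) *\<^sub>R a1 \<sigma> + ((\<theta> * h x)\<^sup>2 / 2) *\<^sub>R (a2 \<sigma> + D \<sigma> G1) + (h x)\<^sup>2 *\<^sub>R D \<sigma> e))"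
proof -
  let ?w = "\<lambda>x. y0 + (\<theta> * h x) *\<^sub>R G0"
  let ?q = "\<lambda>x. ((\<theta> * h x)\<^sup>2 / 2) *\<^sub>R G1 + (h x)\<^sup>2 *\<^sub>R e"
  have q: "?q x = (h x)\<^sup>2 *\<^sub>R ((\<theta>\<^sup>2 / 2) *\<^sub>R G1 + e)" for x
    by (simp add: scaleR_add_right power_mult_distrib mult.commute)
  have 2: "bigo_pow F h 2 ?q" unfolding q by (rule bigo_pow_power)
  have Z2: "bigo_pow F h 2 (\<lambda>x. Z x - ?w x)"
    using bigo_pow_add[OF bigo_pow_mono[OF assms(3,2), of 2] 2] by (simp add: algebra_simps)
  have w1: "bigo_pow F h 1 (\<lambda>x. ?w x - y0)" using bigo_pow_line by simp
  have Z1: "bigo_pow F h 1 (\<lambda>x. Z x - y0)"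
    using bigo_pow_add[OF bigo_pow_mono[OF Z2 assms(2), of 1] w1] by simp
  have "bigo_pow F h (Suc 2) (\<lambda>x. g \<sigma> (t0 + \<theta> * h x, Z x) - g \<sigma> (t0 + \<theta> * h x, ?w x)
      - frechet_derivative (g \<sigma>) (at (t0, y0)) ((t0 + \<theta> * h x, Z x) - (t0 + \<theta> * h x, ?w x)))"
    using assms(1,2) Z1 Z2 w1
    by (intro bigo_pow_Cm_linearization Cm_g)
       (auto intro!: bigo_pow_Pair bigo_pow_time bigo_pow_zero simp del: One_nat_def)
  then have A: "bigo_pow F h 3 (\<lambda>x. f \<sigma> (t0 + \<theta> * h x) (Z x) - f \<sigma> (t0 + \<theta> * h x) (?w x)
      - D \<sigma> (Z x - ?w x))"
    by (simp add: D_def eval_nat_numeral)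
  interpret D: bounded_linear "D \<sigma>" using assms(1) by (rule bounded_linear_D)
  have B: "bigo_pow F h 3 (\<lambda>x. D \<sigma> (Z x - (?w x + ((\<theta> * h x)\<^sup>2 / 2) *\<^sub>R G1 + (h x)\<^sup>2 *\<^sub>R e)))"
    by (rule bigo_pow_bounded_linear[OF D.bounded_linear_axioms assms(3)])
  from bigo_pow_add[OF bigo_pow_add[OF A B] rhs_expand_line(2)[OF assms(1,2), of \<theta>]]
  show ?thesis by (simp add: D.diff D.add D.scaleR algebra_simps)
qed

text \<open>Only the first derivative of \<open>y\<close> is available. Continuity bounds the
  right-hand side near \<open>t0\<close>; then each round inserts the current expansion into the
  right-hand side and integrates, which gains one power of \<open>s\<close>.\<close>

lemma exact_expansion:
  assumes "exact_solution (\<lambda>t x. \<Sum>\<sigma>\<in>S. f \<sigma> t x) t0 T y" "y t0 = y0"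
  shows "bigo_pow (at_right 0) (\<lambda>s. s) 4
    (\<lambda>s. y (t0 + s) - (y0 + s *\<^sub>R G0 + (s\<^sup>2 / 2) *\<^sub>R G1 + (s ^ 3 / 6) *\<^sub>R G2))"
proof -
  have T: "T > 0" using assms(1) by (simp add: exact_solution_def)
  let ?N = "inf (nhds 0) (principal {0..T})"
  let ?Y = "\<lambda>s. y (t0 + s)"
  let ?F = "\<lambda>s. \<Sum>\<sigma>\<in>S. f \<sigma> (t0 + s) (?Y s)"
  have lim: "((\<lambda>s. s) \<longlongrightarrow> 0) ?N" by (rule tendsto_ident_inf_nhds)
  have dY: "(?Y has_vector_derivative ?F s) (at s within {0..T})" if "s \<in> {0..T}" for s
  proof -
    have "((\<lambda>s. t0 + s) has_vector_derivative 1) (at s within {0..T})"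
      by (auto intro!: derivative_eq_intros)
    moreover have "(y has_vector_derivative ?F s) (at (t0 + s) within (\<lambda>s. t0 + s) ` {0..T})"
      using assms(1) that by (auto simp: exact_solution_def add.commute)
    ultimately show ?thesis
      using vector_diff_chain_within[of "\<lambda>s. t0 + s" 1 s "{0..T}" y "?F s"] by (simp add: o_def)
  qed
  have integrate: "bigo_pow ?N (\<lambda>s. s) (Suc k) (\<lambda>s. ?Y s - P s)"
    if "bigo_pow ?N (\<lambda>s. s) k (\<lambda>s. ?F s - P' s)" "P 0 = y0"
      "\<And>s. (P has_vector_derivative P' s) (at s within {0..T})" for P P' k
    using that T assms(2)
    by (intro bigo_pow_integrate[where R' = "\<lambda>s. ?F s - P' s"])
       (auto intro!: has_vector_derivative_diff dY)
  have "(?Y \<longlongrightarrow> ?Y 0) (at 0 within {0..T})"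
    using has_vector_derivative_continuous[OF dY[of 0]] T by (simp add: continuous_within)
  then have "(?Y \<longlongrightarrow> y0) ?N"
    using tendsto_at_within_iff_tendsto_nhds[of ?Y 0 "{0..T}"] assms(2) by simp
  then have "((\<lambda>s. g \<sigma> (t0 + s, ?Y s)) \<longlongrightarrow> g \<sigma> (t0, y0)) ?N" if "\<sigma> \<in> S" for \<sigma>
    using that lim
    by (intro isCont_tendsto_compose[OF isCont_g] tendsto_Pair) (auto intro!: tendsto_eq_intros)
  then have "bigo_pow ?N (\<lambda>s. s) 0 ?F"
    by (intro bigo_pow_sum) (auto intro: tendsto_imp_bigo_pow_0)
  then have "bigo_pow ?N (\<lambda>s. s) (Suc 0) (\<lambda>s. ?Y s - y0)"
    by (intro integrate[where P' = "\<lambda>s. 0"]) (auto intro!: derivative_eq_intros)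
  then have "bigo_pow ?N (\<lambda>s. s) 1 (\<lambda>s. \<Sum>\<sigma>\<in>S. f \<sigma> (t0 + 1 * s) (?Y s) - f \<sigma> t0 y0)"
    by (intro bigo_pow_sum rhs_expand_0) (auto simp: lim)
  then have "bigo_pow ?N (\<lambda>s. s) (Suc 1) (\<lambda>s. ?Y s - (y0 + s *\<^sub>R G0))"
    by (intro integrate[where P' = "\<lambda>s. G0"])
       (auto intro!: derivative_eq_intros simp: G0_def sum_subtractf)
  then have "bigo_pow ?N (\<lambda>s. s) 2
      (\<lambda>s. \<Sum>\<sigma>\<in>S. f \<sigma> (t0 + 1 * s) (?Y s) - f \<sigma> t0 y0 - (1 * s) *\<^sub>R a1 \<sigma>)"
    by (intro bigo_pow_sum rhs_expand_1) (auto simp: lim numeral_2_eq_2)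
  then have "bigo_pow ?N (\<lambda>s. s) (Suc 2) (\<lambda>s. ?Y s - (y0 + s *\<^sub>R G0 + (s\<^sup>2 / 2) *\<^sub>R G1))"
    by (intro integrate[where P' = "\<lambda>s. G0 + s *\<^sub>R G1"])
       (auto intro!: derivative_eq_intros
          simp: G0_def G1_def sum_subtractf sum.distrib scaleR_sum_right diff_diff_eq)
  \<comment> \<open>The exact solution has no quadratic defect, so \<open>rhs_expand_2\<close> is
    used with \<open>e = 0\<close> and \<open>\<theta> = 1\<close>.\<close>
  then have "bigo_pow ?N (\<lambda>s. s) 3 (\<lambda>s. \<Sum>\<sigma>\<in>S. f \<sigma> (t0 + 1 * s) (?Y s) -
     (f \<sigma> t0 y0 + (1 * s) *\<^sub>R a1 \<sigma> + ((1 * s)\<^sup>2 / 2) *\<^sub>R (a2 \<sigma> + D \<sigma> G1) + s\<^sup>2 *\<^sub>R D \<sigma> 0))"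
    by (intro bigo_pow_sum rhs_expand_2) (auto simp: lim eval_nat_numeral)
  then have "bigo_pow ?N (\<lambda>s. s) 3 (\<lambda>s. ?F s - (G0 + s *\<^sub>R G1 + (s\<^sup>2 / 2) *\<^sub>R G2))"
    by (rule bigo_pow_eq)
       (simp add: G0_def G1_def G2_def sum_subtractf sum.distrib scaleR_sum_right scaleR_add_right
          linear_0[OF bounded_linear.linear[OF bounded_linear_D]] cong: sum.cong)
  then have "bigo_pow ?N (\<lambda>s. s) (Suc 3)
      (\<lambda>s. ?Y s - (y0 + s *\<^sub>R G0 + (s\<^sup>2 / 2) *\<^sub>R G1 + (s ^ 3 / 6) *\<^sub>R G2))"
    by (rule integrate) (auto intro!: derivative_eq_intros)
  moreover have "at_right 0 \<le> ?N"
    unfolding at_within_Icc_at_right[OF T, symmetric] unfolding at_within_def by (intro inf_mono) auto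
  then have "filterlim (\<lambda>s. s) ?N (at_right 0)"
    by (rule filterlim_mono[OF filterlim_ident _ order_refl])
  ultimately show ?thesis using bigo_pow_compose by fastforce
qed

text \<open>
  The stages are compared with the Taylor polynomial of the exact solution rather than with the
  solution itself, which need not exist at \<open>t0 + C l * h\<close> when \<open>C l\<close> is negative.
\<close>

lemma additive_expansion:
  assumes K: "finite K" and lim: "(h \<longlongrightarrow> 0) F"
    and stages: "eventually (\<lambda>x. additive_stages K S \<alpha> C f t0 y0 (h x) (Z x)) F"
    and ball: "eventually (\<lambda>x. \<forall>k\<in>K. norm (Z x k - y0) \<le> r) F"
    and consistent: "\<And>\<sigma> k. \<sigma> \<in> S \<Longrightarrow> k \<in> K \<Longrightarrow> (\<Sum>l\<in>K. \<alpha> \<sigma> k l) = C k"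
    and order1: "\<And>\<sigma>. \<sigma> \<in> S \<Longrightarrow> (\<Sum>l\<in>K. \<beta> \<sigma> l) = 1"
    and order2: "\<And>\<sigma>. \<sigma> \<in> S \<Longrightarrow> (\<Sum>l\<in>K. \<beta> \<sigma> l * C l) = 1 / 2"
    and order3: "\<And>\<sigma>. \<sigma> \<in> S \<Longrightarrow> (\<Sum>l\<in>K. \<beta> \<sigma> l * (C l)\<^sup>2) = 1 / 3"
    and order3': "\<And>\<sigma> \<nu>. \<sigma> \<in> S \<Longrightarrow> \<nu> \<in> S \<Longrightarrow> (\<Sum>k\<in>K. \<beta> \<sigma> k * (\<Sum>l\<in>K. \<alpha> \<nu> k l * C l)) = 1 / 6"
  shows "bigo_pow F h 4 (\<lambda>x. h x *\<^sub>R (\<Sum>\<sigma>\<in>S. \<Sum>l\<in>K. \<beta> \<sigma> l *\<^sub>R f \<sigma> (t0 + C l * h x) (Z x l))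
     - (h x *\<^sub>R G0 + ((h x)\<^sup>2 / 2) *\<^sub>R G1 + ((h x) ^ 3 / 6) *\<^sub>R G2))"
proof -
  let ?f = "\<lambda>x \<sigma> l. f \<sigma> (t0 + C l * h x) (Z x l)"
  have Z: "eventually (\<lambda>x. Z x k = y0 + h x *\<^sub>R (\<Sum>\<sigma>\<in>S. \<Sum>l\<in>K. \<alpha> \<sigma> k l *\<^sub>R ?f x \<sigma> l)) F"
    if "k \<in> K" for k
    using stages by eventually_elim (use that in \<open>auto simp: additive_stages_def\<close>)
  have sums: "bigo_pow F h m (\<lambda>x. \<Sum>\<sigma>\<in>S. \<Sum>l\<in>K. \<gamma> \<sigma> l *\<^sub>R (?f x \<sigma> l - a x \<sigma> l))"
    if "\<And>\<sigma> l. \<sigma> \<in> S \<Longrightarrow> l \<in> K \<Longrightarrow> bigo_pow F h m (\<lambda>x. ?f x \<sigma> l - a x \<sigma> l)" for \<gamma> a m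
    using that by (intro bigo_pow_sum bigo_pow_scaleR)
  \<comment> \<open>The factor \<open>h\<close> in the stage equations gains one power: right-hand
    sides known to order \<open>m\<close> determine the stages to order
    \<open>m + 1\<close>.\<close>
  have stage_step: "bigo_pow F h (Suc m) (\<lambda>x. Z x k - (y0 + h x *\<^sub>R (\<Sum>\<sigma>\<in>S. \<Sum>l\<in>K. \<alpha> \<sigma> k l *\<^sub>R a x \<sigma> l)))"
    if "\<And>\<sigma> l. \<sigma> \<in> S \<Longrightarrow> l \<in> K \<Longrightarrow> bigo_pow F h m (\<lambda>x. ?f x \<sigma> l - a x \<sigma> l)" "k \<in> K" for a m k
    by (rule bigo_pow_cong[OF bigo_pow_times[OF sums[where \<gamma> = "\<lambda>\<sigma> l. \<alpha> \<sigma> k l", OF that(1)]]],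
        assumption, assumption, use Z[OF that(2)] in eventually_elim)
       (simp add: scaleR_diff_right sum_subtractf)
  \<comment> \<open>The start of the bootstrap. Nothing yet says that the stages tend to
    \<open>y0\<close>, but the radius \<open>r\<close> confines them to a compact set, on which each
    colour is bounded.\<close>
  have bdd: "bigo_pow F h 0 (\<lambda>x. ?f x \<sigma> l - 0)" if \<sigma>: "\<sigma> \<in> S" and l: "l \<in> K" for \<sigma> l
  proof -
    let ?B = "cball t0 1 \<times> cball y0 r"
    have "compact (g \<sigma> ` ?B)"
      using isCont_g[OF \<sigma>]
      by (intro compact_continuous_image continuous_at_imp_continuous_on compact_Times) auto
    then obtain M where M: "\<And>p. p \<in> ?B \<Longrightarrow> norm (g \<sigma> p) \<le> M"
      by (metis bounded_iff compact_imp_bounded image_eqI)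
    have "eventually (\<lambda>x. norm (?f x \<sigma> l - 0) \<le> M * \<bar>h x\<bar> ^ 0) F"
      using ball tendstoD[OF tendsto_time[OF lim, of "C l"] zero_less_one]
    proof eventually_elim
      case (elim x)
      then have "norm (g \<sigma> (t0 + C l * h x, Z x l)) \<le> M"
        using l by (intro M) (auto simp: dist_commute dist_norm norm_minus_commute)
      then show ?case by simp
    qed
    then show ?thesis by (rule bigo_powI)
  qed
  have o1: "bigo_pow F h 1 (\<lambda>x. Z x k - y0)" if "k \<in> K" for k
    using stage_step[where a = "\<lambda>x \<sigma> l. 0", OF bdd that] by simp
  have o2: "bigo_pow F h 2 (\<lambda>x. Z x k - (y0 + (C k * h x) *\<^sub>R G0))" if k: "k \<in> K" for k
  proof -
    have "(\<Sum>\<sigma>\<in>S. \<Sum>l\<in>K. \<alpha> \<sigma> k l *\<^sub>R f \<sigma> t0 y0) = C k *\<^sub>R G0"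
      using k by (simp add: G0_def scaleR_sum_right scaleR_sum_left[symmetric] consistent)
    then show ?thesis
      using stage_step[where a = "\<lambda>x \<sigma> l. f \<sigma> t0 y0", OF rhs_expand_0[OF _ lim o1] k]
      by (simp add: mult.commute numeral_2_eq_2)
  qed
  \<comment> \<open>A stage integrating linear functions exactly would have the coefficient
    \<open>C^2/2\<close> here, hence zero defect.\<close>
  define e where "e k = (\<Sum>\<sigma>\<in>S. ((\<Sum>l\<in>K. \<alpha> \<sigma> k l * C l) - (C k)\<^sup>2 / 2) *\<^sub>R a1 \<sigma>)" for k
  have o3: "bigo_pow F h 3 (\<lambda>x. Z x k - (y0 + (C k * h x) *\<^sub>R G0 + ((C k * h x)\<^sup>2 / 2) *\<^sub>R G1 + (h x)\<^sup>2 *\<^sub>R e k))"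
    if k: "k \<in> K" for k
  proof -
    have "bigo_pow F h 2 (\<lambda>x. ?f x \<sigma> l - (f \<sigma> t0 y0 + (C l * h x) *\<^sub>R a1 \<sigma>))"
      if "\<sigma> \<in> S" "l \<in> K" for \<sigma> l
      using rhs_expand_1[OF that(1) lim o2[OF that(2)]] by (simp add: diff_diff_eq)
    from stage_step[OF this k]
    have "bigo_pow F h 3 (\<lambda>x. Z x k - (y0 + h x *\<^sub>R (\<Sum>\<sigma>\<in>S. \<Sum>l\<in>K. \<alpha> \<sigma> k l *\<^sub>R (f \<sigma> t0 y0 + (C l * h x) *\<^sub>R a1 \<sigma>))))"
      by (simp add: numeral_3_eq_3 numeral_2_eq_2)
    moreover have "h x *\<^sub>R (\<Sum>\<sigma>\<in>S. \<Sum>l\<in>K. \<alpha> \<sigma> k l *\<^sub>R (f \<sigma> t0 y0 + (C l * h x) *\<^sub>R a1 \<sigma>))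
        = (C k * h x) *\<^sub>R G0 + ((C k * h x)\<^sup>2 / 2) *\<^sub>R G1 + (h x)\<^sup>2 *\<^sub>R e k" for x
    proof -
      have "(\<Sum>l\<in>K. \<alpha> \<sigma> k l *\<^sub>R (f \<sigma> t0 y0 + (C l * h x) *\<^sub>R a1 \<sigma>))
          = C k *\<^sub>R f \<sigma> t0 y0 + (h x * (\<Sum>l\<in>K. \<alpha> \<sigma> k l * C l)) *\<^sub>R a1 \<sigma>" if "\<sigma> \<in> S" for \<sigma>
        using that k
        by (simp add: scaleR_add_right sum.distrib scaleR_sum_left[symmetric] consistent
            sum_distrib_left mult_ac)
      then have "(\<Sum>\<sigma>\<in>S. \<Sum>l\<in>K. \<alpha> \<sigma> k l *\<^sub>R (f \<sigma> t0 y0 + (C l * h x) *\<^sub>R a1 \<sigma>))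
          = C k *\<^sub>R G0 + h x *\<^sub>R (\<Sum>\<sigma>\<in>S. (\<Sum>l\<in>K. \<alpha> \<sigma> k l * C l) *\<^sub>R a1 \<sigma>)"
        by (simp add: sum.distrib scaleR_sum_right G0_def)
      also have "(\<Sum>\<sigma>\<in>S. (\<Sum>l\<in>K. \<alpha> \<sigma> k l * C l) *\<^sub>R a1 \<sigma>) = e k + ((C k)\<^sup>2 / 2) *\<^sub>R G1"
        by (simp add: e_def G1_def scaleR_diff_left sum_subtractf scaleR_sum_right)
      finally show ?thesis
        by (simp add: scaleR_add_right power_mult_distrib power2_eq_square mult_ac)
    qed
    ultimately show ?thesis by (simp add: add.assoc)
  qed
  have "bigo_pow F h (Suc 3) (\<lambda>x. h x *\<^sub>R (\<Sum>\<sigma>\<in>S. \<Sum>l\<in>K. \<beta> \<sigma> l *\<^sub>R (?f x \<sigma> l -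
     (f \<sigma> t0 y0 + (C l * h x) *\<^sub>R a1 \<sigma> + ((C l * h x)\<^sup>2 / 2) *\<^sub>R (a2 \<sigma> + D \<sigma> G1) + (h x)\<^sup>2 *\<^sub>R D \<sigma> (e l)))))"
    by (intro bigo_pow_times sums rhs_expand_2 lim o3)
  moreover have "(\<Sum>\<sigma>\<in>S. \<Sum>l\<in>K. \<beta> \<sigma> l *\<^sub>R
     (f \<sigma> t0 y0 + (C l * h x) *\<^sub>R a1 \<sigma> + ((C l * h x)\<^sup>2 / 2) *\<^sub>R (a2 \<sigma> + D \<sigma> G1) + (h x)\<^sup>2 *\<^sub>R D \<sigma> (e l)))
     = G0 + (h x / 2) *\<^sub>R G1 + ((h x)\<^sup>2 / 6) *\<^sub>R G2" for x
  proof -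
    have *: "(\<Sum>l\<in>K. \<beta> \<sigma> l *\<^sub>R
       (f \<sigma> t0 y0 + (C l * h x) *\<^sub>R a1 \<sigma> + ((C l * h x)\<^sup>2 / 2) *\<^sub>R (a2 \<sigma> + D \<sigma> G1) + (h x)\<^sup>2 *\<^sub>R D \<sigma> (e l)))
       = f \<sigma> t0 y0 + (h x / 2) *\<^sub>R a1 \<sigma> + ((h x)\<^sup>2 / 6) *\<^sub>R (a2 \<sigma> + D \<sigma> G1)" if \<sigma>: "\<sigma> \<in> S" for \<sigma>
    proof -
      interpret D: bounded_linear "D \<sigma>" using \<sigma> by (rule bounded_linear_D)
      have "(\<Sum>l\<in>K. \<beta> \<sigma> l *\<^sub>R e l)
          = (\<Sum>\<nu>\<in>S. (\<Sum>l\<in>K. \<beta> \<sigma> l * ((\<Sum>m\<in>K. \<alpha> \<nu> l m * C m) - (C l)\<^sup>2 / 2)) *\<^sub>R a1 \<nu>)"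
        by (simp add: e_def scaleR_sum_right scaleR_sum_left) (rule sum.swap)
      \<comment> \<open>The weighted defects cancel colour by colour, because
        \<open>1/6 - (1/3)/2 = 0\<close>.\<close>
      also have "\<dots> = (\<Sum>\<nu>\<in>S. 0)"
      proof (rule sum.cong[OF refl])
        fix \<nu> assume \<nu>: "\<nu> \<in> S"
        have "(\<Sum>l\<in>K. \<beta> \<sigma> l * ((\<Sum>m\<in>K. \<alpha> \<nu> l m * C m) - (C l)\<^sup>2 / 2)) = 0"
          using order3[OF \<sigma>] order3'[OF \<sigma> \<nu>]
          by (simp add: right_diff_distrib sum_subtractf sum_divide_distrib[symmetric])
        then show "(\<Sum>l\<in>K. \<beta> \<sigma> l * ((\<Sum>m\<in>K. \<alpha> \<nu> l m * C m) - (C l)\<^sup>2 / 2)) *\<^sub>R a1 \<nu> = 0"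
          by simp
      qed
      finally have "(\<Sum>l\<in>K. \<beta> \<sigma> l *\<^sub>R e l) = 0" by simp
      then have "D \<sigma> (\<Sum>l\<in>K. \<beta> \<sigma> l *\<^sub>R e l) = 0" by (simp add: D.zero)
      then have De: "(\<Sum>l\<in>K. \<beta> \<sigma> l *\<^sub>R D \<sigma> (e l)) = 0" by (simp add: D.sum D.scaleR)
      have "(\<Sum>l\<in>K. \<beta> \<sigma> l *\<^sub>R
       (f \<sigma> t0 y0 + (C l * h x) *\<^sub>R a1 \<sigma> + ((C l * h x)\<^sup>2 / 2) *\<^sub>R (a2 \<sigma> + D \<sigma> G1) + (h x)\<^sup>2 *\<^sub>R D \<sigma> (e l)))
       = (\<Sum>l\<in>K. \<beta> \<sigma> l) *\<^sub>R f \<sigma> t0 y0 + (h x * (\<Sum>l\<in>K. \<beta> \<sigma> l * C l)) *\<^sub>R a1 \<sigma>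
         + ((h x)\<^sup>2 / 2 * (\<Sum>l\<in>K. \<beta> \<sigma> l * (C l)\<^sup>2)) *\<^sub>R (a2 \<sigma> + D \<sigma> G1)
         + (h x)\<^sup>2 *\<^sub>R (\<Sum>l\<in>K. \<beta> \<sigma> l *\<^sub>R D \<sigma> (e l))"
        unfolding scaleR_sum_left scaleR_sum_right sum_distrib_left sum.distrib[symmetric]
        by (intro sum.cong refl)
           (simp add: scaleR_add_right power_mult_distrib mult_ac)
      also have "\<dots> = f \<sigma> t0 y0 + (h x / 2) *\<^sub>R a1 \<sigma> + ((h x)\<^sup>2 / 6) *\<^sub>R (a2 \<sigma> + D \<sigma> G1)"
        unfolding order1[OF \<sigma>] order2[OF \<sigma>] order3[OF \<sigma>] De by simp
      finally show ?thesis .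
    qed
    have "(\<Sum>\<sigma>\<in>S. f \<sigma> t0 y0 + (h x / 2) *\<^sub>R a1 \<sigma> + ((h x)\<^sup>2 / 6) *\<^sub>R (a2 \<sigma> + D \<sigma> G1))
        = G0 + (h x / 2) *\<^sub>R G1 + ((h x)\<^sup>2 / 6) *\<^sub>R G2"
      by (simp add: G0_def G1_def G2_def scaleR_sum_right scaleR_add_right sum.distrib)
    then show ?thesis by (rule trans[OF sum.cong[OF refl *], rotated])
  qed
  ultimately show ?thesis
    by (simp add: scaleR_diff_right sum_subtractf scaleR_add_right power2_eq_square power3_eq_cube mult_ac)
qed

end

section \<open>Solvability of the stage equations for small steps\<close>

lemma contraction_fixed_point:
  fixes \<Phi> :: "('k \<Rightarrow> 'a::banach) \<Rightarrow> 'k \<Rightarrow> 'a"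
  assumes K: "finite K" and r: "r \<ge> 0"
    and self: "\<And>Z k. (\<And>k. k \<in> K \<Longrightarrow> norm (Z k - y) \<le> r) \<Longrightarrow> k \<in> K \<Longrightarrow> norm (\<Phi> Z k - y) \<le> r"
    and contr: "\<And>Z W B k. (\<And>k. k \<in> K \<Longrightarrow> norm (Z k - y) \<le> r) \<Longrightarrow>
      (\<And>k. k \<in> K \<Longrightarrow> norm (W k - y) \<le> r) \<Longrightarrow>
      (\<And>k. k \<in> K \<Longrightarrow> norm (Z k - W k) \<le> B) \<Longrightarrow> k \<in> K \<Longrightarrow> norm (\<Phi> Z k - \<Phi> W k) \<le> B / 2"
  shows "\<exists>Z. \<forall>k\<in>K. norm (Z k - y) \<le> r \<and> Z k = \<Phi> Z k"
proof -
  \<comment> \<open>Picard iteration from the constant \<open>y\<close>. Convergence is shown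
    component by component, as only the values on \<open>K\<close> are controlled; the common bound
    \<open>B\<close> in \<open>contr\<close> takes the place of the supremum distance.\<close>
  define X where "X m = (\<Phi> ^^ m) (\<lambda>_. y)" for m
  have X_Suc: "X (Suc m) = \<Phi> (X m)" for m by (simp add: X_def)
  have ball: "norm (X m k - y) \<le> r" if "k \<in> K" for m k
    using that
  proof (induction m arbitrary: k)
    case 0
    then show ?case using r by (simp add: X_def)
  next
    case (Suc m)
    then show ?case unfolding X_Suc by (intro self)
  qed
  have diff: "norm (X (Suc m) k - X m k) \<le> r * (1 / 2) ^ m" if "k \<in> K" for m k
    using that
  proof (induction m arbitrary: k)
    case 0
    then show ?case using ball[of k 1] by (simp add: X_def)
  next
    case (Suc m)
    have "norm (\<Phi> (X (Suc m)) k - \<Phi> (X m) k) \<le> r * (1 / 2) ^ m / 2"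
      using Suc by (intro contr ball) auto
    then show ?case by (simp add: X_Suc)
  qed
  have "\<exists>z. (\<lambda>m. X m k) \<longlonglongrightarrow> z" if k: "k \<in> K" for k
  proof -
    have "summable (\<lambda>m. X (Suc m) k - X m k)"
      by (rule summable_comparison_test'[of "\<lambda>m. r * (1 / 2) ^ m" 0])
         (auto intro!: summable_mult summable_geometric diff k)
    then have "(\<lambda>n. \<Sum>m<n. X (Suc m) k - X m k) \<longlonglongrightarrow> (\<Sum>m. X (Suc m) k - X m k)"
      by (rule summable_LIMSEQ)
    then have "(\<lambda>n. X n k - X 0 k) \<longlonglongrightarrow> (\<Sum>m. X (Suc m) k - X m k)"
      by (simp add: sum_lessThan_telescope[of "\<lambda>m. X m k"])
    from tendsto_add[OF this tendsto_const[of "X 0 k"]] show ?thesis by auto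
  qed
  then obtain Z where Z: "\<And>k. k \<in> K \<Longrightarrow> (\<lambda>m. X m k) \<longlonglongrightarrow> Z k"
    by metis
  have Zball: "norm (Z k - y) \<le> r" if "k \<in> K" for k
    using that ball by (intro Lim_norm_ubound[OF _ tendsto_diff[OF Z tendsto_const]]) auto
  have "Z k = \<Phi> Z k" if k: "k \<in> K" for k
  proof -
    \<comment> \<open>The sum of all componentwise errors serves as a common bound that dominates
      each error and still tends to 0.\<close>
    define B where "B m = (\<Sum>k\<in>K. norm (X m k - Z k))" for m
    have "B \<longlonglongrightarrow> (\<Sum>k\<in>K. 0)"
      unfolding B_def using Z by (intro tendsto_sum tendsto_norm_zero LIM_zero)
    then have lim: "(\<lambda>m. B m / 2) \<longlonglongrightarrow> 0"
      using tendsto_divide[OF _ tendsto_const, of B 0 sequentially 2] by simp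
    have "norm (\<Phi> (X m) k - \<Phi> Z k) \<le> B m / 2" for m
      using K k by (intro contr ball Zball) (auto simp: B_def intro: member_le_sum)
    then have "(\<lambda>m. X (Suc m) k - \<Phi> Z k) \<longlonglongrightarrow> 0"
      by (intro Lim_null_comparison[OF _ lim]) (simp add: X_Suc)
    then have "(\<lambda>m. X (Suc m) k) \<longlonglongrightarrow> \<Phi> Z k" by (rule LIM_zero_cancel)
    moreover have "(\<lambda>m. X (Suc m) k) \<longlonglongrightarrow> Z k" using Z[OF k] by (rule LIMSEQ_Suc)
    ultimately show ?thesis using LIMSEQ_unique by blast
  qed
  then show ?thesis using Zball by blast
qed

text \<open>The bound \<open>r \<le> 1 / 2\<close> works twice: with time shifts below
  \<open>1/2\<close> it keeps all arguments in the unit ball where the Lipschitz constants hold, and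
  it makes a map with Lipschitz constant at most \<open>r\<close> contract by one half.\<close>

lemma (in smooth_additive) stages_exist:
  assumes K: "finite K" and r: "0 < r" "r \<le> 1 / 2"
  shows "eventually (\<lambda>H. \<exists>Z. additive_stages K S \<alpha> C f t0 y0 H Z \<and>
    (\<forall>k\<in>K. norm (Z k - y0) \<le> r)) (at_right 0)"
proof -
  let ?B = "cball (t0, y0) 1"
  have "\<exists>L\<ge>0. \<forall>u\<in>?B. \<forall>w\<in>?B. norm (g \<sigma> u - g \<sigma> w) \<le> L * norm (u - w)" if "\<sigma> \<in> S" for \<sigma>
  proof (rule Cm_lipschitz[OF Cm_g[OF that], of "(t0, y0)"])
    fix L assume "L \<ge> 0" "\<And>u w. u \<in> ?B \<Longrightarrow> w \<in> ?B \<Longrightarrow> norm (g \<sigma> u - g \<sigma> w) \<le> L * norm (u - w)"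
    then show ?thesis by blast
  qed simp
  then obtain L where L: "\<And>\<sigma>. \<sigma> \<in> S \<Longrightarrow> L \<sigma> \<ge> 0"
    "\<And>\<sigma> u w. \<sigma> \<in> S \<Longrightarrow> u \<in> ?B \<Longrightarrow> w \<in> ?B \<Longrightarrow> norm (g \<sigma> u - g \<sigma> w) \<le> L \<sigma> * norm (u - w)"
    by metis
  \<comment> \<open>One constant for both requirements: the summand
    \<open>norm (f \<sigma> t0 y0)\<close> bounds the size of the right-hand sides and
    \<open>L \<sigma>\<close> their variation. \<open>bound\<close> below is used with
    \<open>B = 1\<close> for the self-map and with the stage distance for the contraction.\<close>
  define M where "M k = (\<Sum>\<sigma>\<in>S. \<Sum>l\<in>K. \<bar>\<alpha> \<sigma> k l\<bar> * (norm (f \<sigma> t0 y0) + L \<sigma>))" for k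
  have small: "eventually (\<lambda>H. \<forall>k\<in>K. \<bar>c k * H\<bar> < d) (at_right 0)" if "d > 0" for c :: "_ \<Rightarrow> real" and d
  proof (intro eventually_ball_finite[OF K] ballI)
    fix k
    have "((\<lambda>H. \<bar>c k * H\<bar>) \<longlongrightarrow> 0) (at_right 0)" by (auto intro!: tendsto_eq_intros)
    then show "eventually (\<lambda>H. \<bar>c k * H\<bar> < d) (at_right 0)" using that by (rule order_tendstoD)
  qed
  have "eventually (\<lambda>H::real. H > 0) (at_right 0)" by (simp add: eventually_at_right_less)
  with small[OF r(1), of M] small[of "1/2" C]
  have "eventually (\<lambda>H. (\<forall>k\<in>K. \<bar>M k * H\<bar> < r) \<and> (\<forall>k\<in>K. \<bar>C k * H\<bar> < 1/2) \<and> H > 0) (at_right 0)"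
    by (auto simp: eventually_conj_iff)
  then show ?thesis
  proof eventually_elim
    case (elim H)
    have M: "M k * H \<le> r" if "k \<in> K" for k
      using elim that abs_ge_self[of "M k * H"] by fastforce
    define \<Phi> where "\<Phi> Z k = y0 + H *\<^sub>R (\<Sum>\<sigma>\<in>S. \<Sum>l\<in>K. \<alpha> \<sigma> k l *\<^sub>R f \<sigma> (t0 + C l * H) (Z l))" for Z k
    have mem: "(t0 + C l * H, Z l) \<in> ?B" if "l \<in> K" "norm (Z l - y0) \<le> r" for Z l
    proof -
      have "dist (t0, y0) (t0 + C l * H, Z l) = norm (C l * H, Z l - y0)"
        by (simp add: dist_Pair_Pair norm_Pair dist_norm norm_minus_commute)
      also have "\<dots> \<le> \<bar>C l * H\<bar> + norm (Z l - y0)" using norm_Pair_le[of "C l * H"] by simp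
      also have "\<dots> \<le> 1" using elim that r(2) by force
      finally show ?thesis by simp
    qed
    have bound: "norm (H *\<^sub>R (\<Sum>\<sigma>\<in>S. \<Sum>l\<in>K. \<alpha> \<sigma> k l *\<^sub>R v \<sigma> l)) \<le> (M k * H) * B"
      if v: "\<And>\<sigma> l. \<sigma> \<in> S \<Longrightarrow> l \<in> K \<Longrightarrow> norm (v \<sigma> l) \<le> (norm (f \<sigma> t0 y0) + L \<sigma>) * B"
      for v k and B :: real
    proof -
      have "norm (\<Sum>\<sigma>\<in>S. \<Sum>l\<in>K. \<alpha> \<sigma> k l *\<^sub>R v \<sigma> l)
          \<le> (\<Sum>\<sigma>\<in>S. \<Sum>l\<in>K. \<bar>\<alpha> \<sigma> k l\<bar> * ((norm (f \<sigma> t0 y0) + L \<sigma>) * B))"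
        using v by (intro order_trans[OF norm_sum] sum_mono) (auto intro!: mult_left_mono)
      also have "\<dots> = M k * B" by (simp add: M_def sum_distrib_right mult.assoc)
      finally have "H * norm (\<Sum>\<sigma>\<in>S. \<Sum>l\<in>K. \<alpha> \<sigma> k l *\<^sub>R v \<sigma> l) \<le> H * (M k * B)"
        using elim by (intro mult_left_mono) auto
      then show ?thesis using elim by (simp add: mult_ac)
    qed
    have "\<exists>Z. \<forall>k\<in>K. norm (Z k - y0) \<le> r \<and> Z k = \<Phi> Z k"
    proof (rule contraction_fixed_point[OF K])
      show "0 \<le> r" using r by simp
    next
      fix Z k assume Z: "\<And>k. k \<in> K \<Longrightarrow> norm (Z k - y0) \<le> r" and k: "k \<in> K"
      have v: "norm (f \<sigma> (t0 + C l * H) (Z l)) \<le> (norm (f \<sigma> t0 y0) + L \<sigma>) * 1"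
        if "\<sigma> \<in> S" "l \<in> K" for \<sigma> l
      proof -
        have B: "(t0 + C l * H, Z l) \<in> ?B" using mem[of l Z] Z that by simp
        have "norm (g \<sigma> (t0 + C l * H, Z l) - g \<sigma> (t0, y0)) \<le> L \<sigma> * norm ((t0 + C l * H, Z l) - (t0, y0))"
          using that B by (intro L) auto
        also have "\<dots> \<le> L \<sigma> * 1"
          using B L(1)[OF that(1)]
          by (intro mult_left_mono) (simp_all only: mem_cball dist_norm norm_minus_commute)
        finally show ?thesis
          using norm_triangle_sub[of "f \<sigma> (t0 + C l * H) (Z l)" "f \<sigma> t0 y0"] by simp
      qed
      have "norm (\<Phi> Z k - y0) \<le> (M k * H) * 1"
        unfolding \<Phi>_def add_diff_cancel_left' by (rule bound) (rule v)
      then show "norm (\<Phi> Z k - y0) \<le> r" using M[OF k] by simp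
    next
      fix Z W B k
      assume Z: "\<And>k. k \<in> K \<Longrightarrow> norm (Z k - y0) \<le> r" and W: "\<And>k. k \<in> K \<Longrightarrow> norm (W k - y0) \<le> r"
        and B: "\<And>k. k \<in> K \<Longrightarrow> norm (Z k - W k) \<le> B" and k: "k \<in> K"
      have B0: "B \<ge> 0" using B[OF k] norm_ge_zero order_trans by blast
      have v: "norm (f \<sigma> (t0 + C l * H) (Z l) - f \<sigma> (t0 + C l * H) (W l)) \<le> (norm (f \<sigma> t0 y0) + L \<sigma>) * B"
        if "\<sigma> \<in> S" "l \<in> K" for \<sigma> l
      proof -
        have "norm (g \<sigma> (t0 + C l * H, Z l) - g \<sigma> (t0 + C l * H, W l))
            \<le> L \<sigma> * norm ((t0 + C l * H, Z l) - (t0 + C l * H, W l))"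
          using that mem Z W by (intro L) auto
        also have "\<dots> \<le> (norm (f \<sigma> t0 y0) + L \<sigma>) * B"
          using B[OF that(2)] L(1)[OF that(1)] B0
          by (intro mult_mono) (auto simp: norm_Pair)
        finally show ?thesis by simp
      qed
      have "\<Phi> Z k - \<Phi> W k = H *\<^sub>R (\<Sum>\<sigma>\<in>S. \<Sum>l\<in>K. \<alpha> \<sigma> k l *\<^sub>R
          (f \<sigma> (t0 + C l * H) (Z l) - f \<sigma> (t0 + C l * H) (W l)))"
        by (simp add: \<Phi>_def scaleR_diff_right sum_subtractf)
      also have "norm \<dots> \<le> (M k * H) * B" by (rule bound) (rule v)
      also have "\<dots> \<le> 1 / 2 * B" using M[OF k] r B0 by (intro mult_right_mono) auto
      finally show "norm (\<Phi> Z k - \<Phi> W k) \<le> B / 2" by simp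
    qed
    then show ?case by (auto simp: additive_stages_def \<Phi>_def)
  qed
qed

section \<open>Accuracy of additive methods and sufficiency of the third-order conditions\<close>

definition additive_accurate ::
  "('d::finite) itself \<Rightarrow> 'k set \<Rightarrow> 'c set \<Rightarrow> ('c \<Rightarrow> 'k \<Rightarrow> 'k \<Rightarrow> real) \<Rightarrow> ('c \<Rightarrow> 'k \<Rightarrow> real)
     \<Rightarrow> ('k \<Rightarrow> real) \<Rightarrow> nat \<Rightarrow> bool"
where
  "additive_accurate TYPE('d) K S \<alpha> \<beta> C p \<longleftrightarrow>
     (\<exists>m. \<forall>(f :: 'c \<Rightarrow> 'd rhs) t0 T y.
        (\<forall>\<sigma>\<in>S. smooth_rhs m (f \<sigma>)) \<longrightarrow> exact_solution (\<lambda>t x. \<Sum>\<sigma>\<in>S. f \<sigma> t x) t0 T y \<longrightarrow>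
        local_error_order p y t0 (additive_step K S \<alpha> \<beta> C f t0 (y t0)))"

text \<open>
  Filter of pairs of a step size tending to \<open>0\<close> and a solution \<open>Z\<close> of the stage equations
  for it: statements along this filter are uniform in \<open>Z\<close>.
\<close>

definition step_filter :: "(real \<Rightarrow> 'z \<Rightarrow> bool) \<Rightarrow> (real \<times> 'z) filter" where
  "step_filter Q = inf (filtercomap fst (at_right 0)) (principal {(H, Z). Q H Z})"

lemma eventually_step_filter:
  "eventually P (step_filter Q) \<longleftrightarrow> eventually (\<lambda>H. \<forall>Z. Q H Z \<longrightarrow> P (H, Z)) (at_right 0)"
  unfolding step_filter_def eventually_inf_principal eventually_filtercomap
proof safe
  fix R assume "eventually R (at_right 0)" "\<forall>x. R (fst x) \<longrightarrow> x \<in> {(H, Z). Q H Z} \<longrightarrow> P x"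
  then show "eventually (\<lambda>H. \<forall>Z. Q H Z \<longrightarrow> P (H, Z)) (at_right 0)"
    by (auto elim!: eventually_mono)
next
  assume "eventually (\<lambda>H. \<forall>Z. Q H Z \<longrightarrow> P (H, Z)) (at_right 0)"
  then show "\<exists>R. eventually R (at_right 0) \<and> (\<forall>x. R (fst x) \<longrightarrow> x \<in> {(H, Z). Q H Z} \<longrightarrow> P x)"
    by (intro exI[of _ "\<lambda>H. \<forall>Z. Q H Z \<longrightarrow> P (H, Z)"]) auto
qed

lemma filterlim_fst_step_filter: "filterlim fst (at_right 0) (step_filter Q)"
  by (auto simp: filterlim_iff eventually_step_filter elim: eventually_mono)

lemma tendsto_fst_step_filter: "(fst \<longlongrightarrow> 0) (step_filter Q)"
  using filterlim_fst_step_filter filterlim_at by blast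

lemma eventually_fst_step_filter: "eventually (\<lambda>x. fst x \<noteq> 0) (step_filter Q)"
  unfolding eventually_step_filter by (rule eventually_mono[OF eventually_at_right_less[of 0]]) simp

lemma eventually_step_filter_Q: "eventually (\<lambda>x. Q (fst x) (snd x)) (step_filter Q)"
  by (simp add: eventually_step_filter)

lemma bigo_pow_step_filter:
  "bigo_pow (step_filter Q) fst p e \<longleftrightarrow>
     (\<exists>C. eventually (\<lambda>H. \<forall>Z. Q H Z \<longrightarrow> norm (e (H, Z)) \<le> C * H ^ p) (at_right 0))"
proof -
  have *: "eventually (\<lambda>H::real. H > 0) (at_right 0)" by (simp add: eventually_at_right_less)
  show ?thesis
    unfolding bigo_pow_def eventually_step_filter
    by (intro ex_cong1 eventually_cong) (use * in \<open>auto elim!: eventually_mono\<close>)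
qed

text \<open>Separates solvability from the uniform error bound and expresses the latter in the
  \<open>bigo_pow\<close> calculus, which is then used for both sufficiency and necessity.\<close>

lemma local_error_order_additive_step:
  "local_error_order p y t0 (additive_step K S \<alpha> \<beta> C f t0 (y t0)) \<longleftrightarrow>
   (\<exists>r>0. eventually (\<lambda>H. \<exists>Z. additive_stages K S \<alpha> C f t0 (y t0) H Z \<and> (\<forall>k\<in>K. norm (Z k - y t0) \<le> r)) (at_right 0)
     \<and> bigo_pow (step_filter (\<lambda>H Z. additive_stages K S \<alpha> C f t0 (y t0) H Z \<and> (\<forall>k\<in>K. norm (Z k - y t0) \<le> r)))
         fst (p + 1) (\<lambda>x. y t0 + fst x *\<^sub>R (\<Sum>\<sigma>\<in>S. \<Sum>l\<in>K. \<beta> \<sigma> l *\<^sub>R f \<sigma> (t0 + C l * fst x) (snd x l)) - y (t0 + fst x)))"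
proof -
  let ?Q = "\<lambda>r H Z. additive_stages K S \<alpha> C f t0 (y t0) H Z \<and> (\<forall>k\<in>K. norm (Z k - y t0) \<le> r)"
  let ?step = "additive_step K S \<alpha> \<beta> C f t0 (y t0)"
  let ?y1 = "\<lambda>H Z. y t0 + H *\<^sub>R (\<Sum>\<sigma>\<in>S. \<Sum>l\<in>K. \<beta> \<sigma> l *\<^sub>R f \<sigma> (t0 + C l * H) (Z l))"
  have ex: "(\<exists>y1. ?step r H y1) \<longleftrightarrow> (\<exists>Z. ?Q r H Z)" for r H
    unfolding additive_step_def by simp
  have all: "(\<forall>y1. ?step r H y1 \<longrightarrow> P y1) \<longleftrightarrow> (\<forall>Z. ?Q r H Z \<longrightarrow> P (?y1 H Z))" for r H P
    unfolding additive_step_def by auto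
  show ?thesis
    unfolding local_error_order_def bigo_pow_step_filter eventually_conj_iff ex all
    by (simp only: fst_conv snd_conv ex_simps)
qed

text \<open>The numerical increment and the exact one have the same cubic Taylor polynomial, so
  their difference is of fourth order; the radius \<open>1/2\<close> is the largest that
  \<open>stages_exist\<close> admits.\<close>

lemma additive_accurate_3I:
  assumes K: "finite K" and S: "finite S"
    and consistent: "\<And>\<sigma> k. \<sigma> \<in> S \<Longrightarrow> k \<in> K \<Longrightarrow> (\<Sum>l\<in>K. \<alpha> \<sigma> k l) = C k"
    and order1: "\<And>\<sigma>. \<sigma> \<in> S \<Longrightarrow> (\<Sum>l\<in>K. \<beta> \<sigma> l) = 1"
    and order2: "\<And>\<sigma>. \<sigma> \<in> S \<Longrightarrow> (\<Sum>l\<in>K. \<beta> \<sigma> l * C l) = 1 / 2"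
    and order3: "\<And>\<sigma>. \<sigma> \<in> S \<Longrightarrow> (\<Sum>l\<in>K. \<beta> \<sigma> l * (C l)\<^sup>2) = 1 / 3"
    and order3': "\<And>\<sigma> \<nu>. \<sigma> \<in> S \<Longrightarrow> \<nu> \<in> S \<Longrightarrow> (\<Sum>k\<in>K. \<beta> \<sigma> k * (\<Sum>l\<in>K. \<alpha> \<nu> k l * C l)) = 1 / 6"
  shows "additive_accurate TYPE('d::finite) K S \<alpha> \<beta> C 3"
  unfolding additive_accurate_def
proof (intro exI[of _ 3] allI impI)
  fix f :: "_ \<Rightarrow> 'd rhs" and t0 T y
  assume smooth: "\<forall>\<sigma>\<in>S. smooth_rhs 3 (f \<sigma>)"
    and exact: "exact_solution (\<lambda>t x. \<Sum>\<sigma>\<in>S. f \<sigma> t x) t0 T y"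
  interpret smooth_additive S f t0 "y t0"
    using S smooth by unfold_locales auto
  let ?Q = "\<lambda>H Z. additive_stages K S \<alpha> C f t0 (y t0) H Z \<and> (\<forall>k\<in>K. norm (Z k - y t0) \<le> 1 / 2)"
  let ?F = "step_filter ?Q"
  have "bigo_pow ?F fst 4 (\<lambda>x. fst x *\<^sub>R (\<Sum>\<sigma>\<in>S. \<Sum>l\<in>K. \<beta> \<sigma> l *\<^sub>R f \<sigma> (t0 + C l * fst x) (snd x l))
     - (fst x *\<^sub>R G0 + ((fst x)\<^sup>2 / 2) *\<^sub>R G1 + ((fst x) ^ 3 / 6) *\<^sub>R G2))"
    using eventually_step_filter_Q[of ?Q]
    by (intro additive_expansion[where r = "1 / 2" and \<alpha> = \<alpha>] assms tendsto_fst_step_filter)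
       (auto elim!: eventually_mono)
  from bigo_pow_diff[OF this
      bigo_pow_compose[OF exact_expansion[OF exact refl] filterlim_fst_step_filter]]
  have "bigo_pow ?F fst 4 (\<lambda>x. y t0 + fst x *\<^sub>R (\<Sum>\<sigma>\<in>S. \<Sum>l\<in>K. \<beta> \<sigma> l *\<^sub>R f \<sigma> (t0 + C l * fst x) (snd x l)) - y (t0 + fst x))"
    by (rule bigo_pow_eq) simp
  then show "local_error_order 3 y t0 (additive_step K S \<alpha> \<beta> C f t0 (y t0))"
    unfolding local_error_order_additive_step
    using stages_exist[OF K, of "1 / 2"] by (intro exI[of _ "1 / 2"]) simp
qed

section \<open>Necessity of the order conditions\<close>

text \<open>Induction needs a family closed under directional differentiation. The free constant
  \<open>w\<close> absorbs the derivative \<open>a *\<^sub>R snd v\<close> of the linear part, which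
  need not be a multiple of \<open>e\<close>.\<close>

lemma Cm_affine_poly:
  fixes e w :: "'a::euclidean_space"
  shows "Cm m (\<lambda>(t, x). a *\<^sub>R x + w + poly P t *\<^sub>R e)"
proof (induction m arbitrary: a w P)
  case 0
  then show ?case by (auto simp: case_prod_unfold intro!: continuous_intros)
next
  case (Suc m)
  have D: "((\<lambda>(t, x). a *\<^sub>R x + w + poly P t *\<^sub>R e) has_derivative
      (\<lambda>v. a *\<^sub>R snd v + (fst v * poly (pderiv P) (fst p)) *\<^sub>R e)) (at p)" for p
  proof -
    have "((\<lambda>q. poly P (fst q)) has_derivative (\<lambda>v. fst v * poly (pderiv P) (fst p))) (at p)"
      by (rule DERIV_compose_FDERIV[OF poly_DERIV]) (auto intro!: derivative_eq_intros)
    then show ?thesis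
      by (auto simp: case_prod_unfold intro!: derivative_eq_intros)
  qed
  have "Cm m (\<lambda>p. frechet_derivative (\<lambda>(t, x). a *\<^sub>R x + w + poly P t *\<^sub>R e) (at p) v)" for v
  proof -
    have "(\<lambda>p. frechet_derivative (\<lambda>(t, x). a *\<^sub>R x + w + poly P t *\<^sub>R e) (at p) v)
        = (\<lambda>(t, x). 0 *\<^sub>R x + a *\<^sub>R snd v + poly (smult (fst v) (pderiv P)) t *\<^sub>R e)"
      unfolding frechet_derivative_at[OF D, symmetric] by (simp add: case_prod_unfold)
    then show ?thesis by (simp only: Suc.IH)
  qed
  moreover have "\<forall>p. (\<lambda>(t, x). a *\<^sub>R x + w + poly P t *\<^sub>R e) differentiable (at p)"
    using D differentiableI by blast
  ultimately show ?case by (simp only: Cm.simps simp_thms)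
qed

text \<open>
  Every test problem has the exact solution \<open>t ^ (k + 1) / (k + 1) *\<^sub>R e\<close>. Choosing the right-hand
  sides \<open>x - t ^ (k + 1) / (k + 1) *\<^sub>R e\<close> and \<open>t ^ k *\<^sub>R e\<close> for two colours isolates their coupling
  condition already in dimension one.
\<close>

lemma additive_accurate_test:
  fixes P :: "'c \<Rightarrow> real poly" and a :: "'c \<Rightarrow> real" and e :: "real ^ ('d::finite)"
  assumes "additive_accurate TYPE('d) K S \<alpha> \<beta> C p"
    and sol: "\<And>t. (\<Sum>\<sigma>\<in>S. a \<sigma>) * (t ^ (k + 1) / (real k + 1)) + (\<Sum>\<sigma>\<in>S. poly (P \<sigma>) t) = t ^ k"
  obtains r where
    "bigo_pow (step_filter (\<lambda>H Z. additive_stages K S \<alpha> C (\<lambda>\<sigma> t x. a \<sigma> *\<^sub>R x + poly (P \<sigma>) t *\<^sub>R e) 0 0 H Z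
        \<and> (\<forall>k\<in>K. norm (Z k) \<le> r))) fst (p + 1)
      (\<lambda>x. fst x *\<^sub>R (\<Sum>\<sigma>\<in>S. \<Sum>l\<in>K. \<beta> \<sigma> l *\<^sub>R (a \<sigma> *\<^sub>R snd x l + poly (P \<sigma>) (C l * fst x) *\<^sub>R e))
         - (fst x ^ (k + 1) / (real k + 1)) *\<^sub>R e)"
    "step_filter (\<lambda>H Z. additive_stages K S \<alpha> C (\<lambda>\<sigma> t x. a \<sigma> *\<^sub>R x + poly (P \<sigma>) t *\<^sub>R e) 0 0 H Z
        \<and> (\<forall>k\<in>K. norm (Z k) \<le> r)) \<noteq> bot"
proof -
  let ?f = "\<lambda>\<sigma> t x. a \<sigma> *\<^sub>R x + poly (P \<sigma>) t *\<^sub>R e"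
  let ?y = "\<lambda>t. (t ^ (k + 1) / (real k + 1)) *\<^sub>R e"
  have smooth: "smooth_rhs m (?f \<sigma>)" for m \<sigma>
    using Cm_affine_poly[of m "a \<sigma>" 0 "P \<sigma>" e] by (simp add: smooth_rhs_def)
  have exact: "exact_solution (\<lambda>t x. \<Sum>\<sigma>\<in>S. ?f \<sigma> t x) 0 1 ?y"
    unfolding exact_solution_def
  proof (intro conjI ballI)
    fix t :: real
    have "(\<Sum>\<sigma>\<in>S. ?f \<sigma> t (?y t))
        = ((\<Sum>\<sigma>\<in>S. a \<sigma>) * (t ^ (k + 1) / (real k + 1)) + (\<Sum>\<sigma>\<in>S. poly (P \<sigma>) t)) *\<^sub>R e"
      by (simp add: sum.distrib scaleR_add_left scaleR_sum_left sum_distrib_right sum_divide_distrib)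
    then have "(\<Sum>\<sigma>\<in>S. ?f \<sigma> t (?y t)) = t ^ k *\<^sub>R e" by (simp only: sol)
    moreover have "((\<lambda>t. t ^ (k + 1) / (real k + 1)) has_real_derivative t ^ k) (at t within {0..0 + 1})"
    proof -
      have "real (Suc k) * t ^ (Suc k - Suc 0) / (real k + 1) = t ^ k"
        using of_nat_neq_0[of k, where 'a = real] by (simp add: add.commute)
      then show ?thesis
        using DERIV_cdivide[OF DERIV_pow[of "Suc k" t "{0..0 + 1}"], of "real k + 1"] by simp
    qed
    from has_vector_derivative_scaleR[OF this has_vector_derivative_const[of e]]
    have "(?y has_vector_derivative t ^ k *\<^sub>R e) (at t within {0..0 + 1})"
      by simp
    ultimately show "(?y has_vector_derivative (\<Sum>\<sigma>\<in>S. ?f \<sigma> t (?y t))) (at t within {0..0 + 1})"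
      by simp
  qed simp
  obtain m where m: "\<And>f t0 T y. (\<forall>\<sigma>\<in>S. smooth_rhs m (f \<sigma>)) \<Longrightarrow>
      exact_solution (\<lambda>t x. \<Sum>\<sigma>\<in>S. (f \<sigma> t x :: real ^ 'd)) t0 T y \<Longrightarrow>
      local_error_order p y t0 (additive_step K S \<alpha> \<beta> C f t0 (y t0))"
    using assms(1) unfolding additive_accurate_def by blast
  have "local_error_order p ?y 0 (additive_step K S \<alpha> \<beta> C ?f 0 (?y 0))"
    by (rule m[where f = ?f and y = ?y, OF _ exact]) (simp add: smooth)
  then obtain r where r: "eventually (\<lambda>H. \<exists>Z. additive_stages K S \<alpha> C ?f 0 0 H Z \<and> (\<forall>k\<in>K. norm (Z k) \<le> r)) (at_right 0)"
    "bigo_pow (step_filter (\<lambda>H Z. additive_stages K S \<alpha> C ?f 0 0 H Z \<and> (\<forall>k\<in>K. norm (Z k) \<le> r)))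
         fst (p + 1) (\<lambda>x. fst x *\<^sub>R (\<Sum>\<sigma>\<in>S. \<Sum>l\<in>K. \<beta> \<sigma> l *\<^sub>R ?f \<sigma> (C l * fst x) (snd x l)) - ?y (fst x))"
    unfolding local_error_order_additive_step[where y = ?y and ?t0.0 = 0] by auto
  let ?F = "step_filter (\<lambda>H Z. additive_stages K S \<alpha> C ?f 0 0 H Z \<and> (\<forall>k\<in>K. norm (Z k) \<le> r))"
  \<comment> \<open>The existence clause of the local error enters here: without stage solutions the
    bound along the filter would be vacuous.\<close>
  have "?F \<noteq> bot"
  proof
    assume "?F = bot"
    then have "eventually (\<lambda>x. False) ?F" by simp
    from this[unfolded eventually_step_filter] r(1) have "eventually (\<lambda>H. False) (at_right (0::real))"
      by eventually_elim blast
    then show False by simp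
  qed
  with r(2) show thesis by (rule that)
qed

text \<open>The colour \<open>\<nu>\<close> carries \<open>t ^ k\<close> and the others vanish. No
  right-hand side depends on the state, so the local error is exactly \<open>h^(k+1)\<close> times
  the defect of the quadrature rule, while \<open>k < p\<close> forces order
  \<open>k + 2\<close>.\<close>

lemma additive_order_quadrature:
  assumes "additive_accurate TYPE('d::finite) K S \<alpha> \<beta> C p" "finite S" "\<nu> \<in> S" "k < p"
  shows "(\<Sum>l\<in>K. \<beta> \<nu> l * C l ^ k) = 1 / (real k + 1)"
proof -
  let ?P = "\<lambda>\<sigma>. if \<sigma> = \<nu> then monom (1::real) k else 0"
  let ?e = "1 :: real ^ 'd"
  have "(\<Sum>\<sigma>\<in>S. 0) * (t ^ (k + 1) / (real k + 1)) + (\<Sum>\<sigma>\<in>S. poly (?P \<sigma>) t) = t ^ k" for t :: real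
  proof -
    have "(\<Sum>\<sigma>\<in>S. poly (?P \<sigma>) t) = (\<Sum>\<sigma>\<in>S. if \<sigma> = \<nu> then t ^ k else 0)"
      by (intro sum.cong) (auto simp: poly_monom)
    then show ?thesis using assms(2,3) by simp
  qed
  note test = additive_accurate_test[OF assms(1) this, of ?e]
  let ?err = "\<lambda>x. fst x *\<^sub>R (\<Sum>\<sigma>\<in>S. \<Sum>l\<in>K. \<beta> \<sigma> l *\<^sub>R (0 *\<^sub>R snd x l + poly (?P \<sigma>) (C l * fst x) *\<^sub>R ?e))
         - (fst x ^ (k + 1) / (real k + 1)) *\<^sub>R ?e"
  obtain Q where o: "bigo_pow (step_filter Q) fst (p + 1) ?err" and nontrivial: "step_filter Q \<noteq> bot"
    by (rule test)
  let ?F = "step_filter Q"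
  have "bigo_pow ?F fst (Suc (k + 1)) ?err"
    using assms(4) by (intro bigo_pow_mono[OF o tendsto_fst_step_filter]) simp
  moreover have "?err x = fst x ^ (k + 1) *\<^sub>R (((\<Sum>l\<in>K. \<beta> \<nu> l * C l ^ k) - 1 / (real k + 1)) *\<^sub>R ?e)" for x
  proof -
    have "(\<Sum>\<sigma>\<in>S. \<Sum>l\<in>K. \<beta> \<sigma> l *\<^sub>R (0 *\<^sub>R snd x l + poly (?P \<sigma>) (C l * fst x) *\<^sub>R ?e))
        = (\<Sum>\<sigma>\<in>S. if \<sigma> = \<nu> then (\<Sum>l\<in>K. (\<beta> \<nu> l * (C l * fst x) ^ k) *\<^sub>R ?e) else 0)"
      by (intro sum.cong) (auto simp: poly_monom)
    also have "\<dots> = fst x ^ k *\<^sub>R ((\<Sum>l\<in>K. \<beta> \<nu> l * C l ^ k) *\<^sub>R ?e)"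
      using assms(2,3)
      by (simp add: scaleR_sum_left[symmetric] sum_distrib_left power_mult_distrib mult_ac)
    finally show ?thesis by (simp add: algebra_simps)
  qed
  ultimately have "bigo_pow ?F fst (Suc (k + 1))
      (\<lambda>x. fst x ^ (k + 1) *\<^sub>R (((\<Sum>l\<in>K. \<beta> \<nu> l * C l ^ k) - 1 / (real k + 1)) *\<^sub>R ?e))"
    by (rule bigo_pow_eq)
  then have "((\<Sum>l\<in>K. \<beta> \<nu> l * C l ^ k) - 1 / (real k + 1)) *\<^sub>R ?e = 0"
    by (rule bigo_pow_const_unique[OF _ tendsto_fst_step_filter eventually_fst_step_filter nontrivial])
  then show ?thesis by simp
qed

text \<open>Colour \<open>\<nu>\<close> drives the stages to \<open>h^(k+1) * \<kappa> i\<close> to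
  leading order, and colour \<open>\<sigma>\<close> sees their deviation from the exact solution. At
  order \<open>h^(k+2)\<close> the error is therefore the weighted sum of the
  \<open>\<kappa> i\<close> minus the quadrature of the exact solution, and
  \<open>k + 2 \<le> p\<close> makes it vanish.\<close>

lemma additive_order_coupling:
  fixes K :: "'k set"
  assumes "additive_accurate TYPE('d::finite) K S \<alpha> \<beta> C p" "finite S" "\<sigma> \<in> S" "\<nu> \<in> S" "k + 2 \<le> p"
  shows "(\<Sum>i\<in>K. \<beta> \<sigma> i * (\<Sum>l\<in>K. \<alpha> \<nu> i l * C l ^ k)) = 1 / ((real k + 1) * (real k + 2))"
proof -
  let ?e = "1 :: real ^ 'd"
  \<comment> \<open>Sums of separate conditionals, not a case distinction, so that
    \<open>\<sigma> = \<nu>\<close> is included: one colour then carries both contributions.\<close>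
  let ?a = "\<lambda>\<tau>. if \<tau> = \<sigma> then 1 else (0::real)"
  let ?P = "\<lambda>\<tau>. (if \<tau> = \<sigma> then monom (- 1 / (real k + 1)) (k + 1) else 0) +
    (if \<tau> = \<nu> then monom (1::real) k else 0)"
  let ?f = "\<lambda>\<tau> t x. ?a \<tau> *\<^sub>R x + poly (?P \<tau>) t *\<^sub>R ?e"
  have P: "poly (?P \<tau>) t = (if \<tau> = \<sigma> then - (t ^ (k + 1) / (real k + 1)) else 0) + (if \<tau> = \<nu> then t ^ k else 0)"
    for \<tau> t by (simp add: poly_monom)
  have "(\<Sum>\<tau>\<in>S. ?a \<tau>) * (t ^ (k + 1) / (real k + 1)) + (\<Sum>\<tau>\<in>S. poly (?P \<tau>) t) = t ^ k" for t :: real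
    unfolding P using assms(2-4) by (simp add: sum.distrib)
  note test = additive_accurate_test[OF assms(1) this, of ?e]
  let ?Q = "\<lambda>r H Z. additive_stages K S \<alpha> C ?f 0 0 H Z \<and> (\<forall>k\<in>K. norm (Z k) \<le> r)"
  let ?err = "\<lambda>x. fst x *\<^sub>R (\<Sum>\<tau>\<in>S. \<Sum>l\<in>K. \<beta> \<tau> l *\<^sub>R ?f \<tau> (C l * fst x) (snd x l))
         - (fst x ^ (k + 1) / (real k + 1)) *\<^sub>R ?e"
  obtain r where o: "bigo_pow (step_filter (?Q r)) fst (p + 1) ?err"
    and nontrivial: "step_filter (?Q r) \<noteq> bot"
    by (rule test)
  let ?F = "step_filter (?Q r)"
  have lim: "(fst \<longlongrightarrow> 0) ?F" by (rule tendsto_fst_step_filter)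
  have sum_f: "(\<Sum>\<tau>\<in>S. \<Sum>l\<in>K. \<gamma> \<tau> l *\<^sub>R ?f \<tau> (C l * h) (z l))
      = (\<Sum>l\<in>K. \<gamma> \<sigma> l *\<^sub>R z l) - h ^ (k + 1) *\<^sub>R (\<Sum>l\<in>K. (\<gamma> \<sigma> l * C l ^ (k + 1) / (real k + 1)) *\<^sub>R ?e)
        + h ^ k *\<^sub>R ((\<Sum>l\<in>K. \<gamma> \<nu> l * C l ^ k) *\<^sub>R ?e)" for \<gamma> h z
  proof -
    have "(\<Sum>l\<in>K. \<gamma> \<tau> l *\<^sub>R ?f \<tau> (C l * h) (z l)) =
      (if \<tau> = \<sigma> then (\<Sum>l\<in>K. \<gamma> \<sigma> l *\<^sub>R z l) - (\<Sum>l\<in>K. (h ^ (k + 1) * (\<gamma> \<sigma> l * C l ^ (k + 1) / (real k + 1))) *\<^sub>R ?e) else 0)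
      + (if \<tau> = \<nu> then (\<Sum>l\<in>K. (h ^ k * (\<gamma> \<nu> l * C l ^ k)) *\<^sub>R ?e) else 0)" for \<tau>
      unfolding P sum_subtractf[symmetric]
      by (auto simp: sum.distrib[symmetric] power_mult_distrib algebra_simps intro!: sum.cong)
    then show ?thesis
      using assms(2-4)
      by (simp add: sum.distrib scaleR_sum_right[symmetric] scaleR_sum_left[symmetric] sum_distrib_left[symmetric])
         (simp add: scaleR_sum_right scaleR_sum_left sum_distrib_left)
  qed
  have stage: "eventually (\<lambda>x. snd x i = fst x *\<^sub>R (\<Sum>l\<in>K. \<alpha> \<sigma> i l *\<^sub>R snd x l)
      - fst x ^ (k + 2) *\<^sub>R (\<Sum>l\<in>K. (\<alpha> \<sigma> i l * C l ^ (k + 1) / (real k + 1)) *\<^sub>R ?e)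
      + fst x ^ (k + 1) *\<^sub>R ((\<Sum>l\<in>K. \<alpha> \<nu> i l * C l ^ k) *\<^sub>R ?e)) ?F" if "i \<in> K" for i
    using eventually_step_filter_Q
  proof eventually_elim
    case (elim x)
    then have "snd x i = fst x *\<^sub>R (\<Sum>\<tau>\<in>S. \<Sum>l\<in>K. \<alpha> \<tau> i l *\<^sub>R ?f \<tau> (C l * fst x) (snd x l))"
      using that by (auto simp: additive_stages_def)
    then show ?case unfolding sum_f by (simp add: scaleR_diff_right scaleR_add_right)
  qed
  \<comment> \<open>The radius gives boundedness, and each pass through the stage equation gains a
    power until the forcing of order \<open>k + 1\<close> limits it.\<close>
  have Z: "bigo_pow ?F fst j (\<lambda>x. snd x i)" if "j \<le> k + 1" "i \<in> K" for i j
    using that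
  proof (induction j arbitrary: i)
    case 0
    have "eventually (\<lambda>x. norm (snd x i) \<le> r * \<bar>fst x\<bar> ^ 0) ?F"
      using eventually_step_filter_Q by eventually_elim (use 0 in auto)
    then show ?case by (rule bigo_powI)
  next
    case (Suc j)
    have "bigo_pow ?F fst (Suc j) (\<lambda>x. fst x *\<^sub>R (\<Sum>l\<in>K. \<alpha> \<sigma> i l *\<^sub>R snd x l)
      - fst x ^ (k + 2) *\<^sub>R (\<Sum>l\<in>K. (\<alpha> \<sigma> i l * C l ^ (k + 1) / (real k + 1)) *\<^sub>R ?e)
      + fst x ^ (k + 1) *\<^sub>R ((\<Sum>l\<in>K. \<alpha> \<nu> i l * C l ^ k) *\<^sub>R ?e))"
      using Suc
      by (intro bigo_pow_add bigo_pow_diff bigo_pow_times bigo_pow_sum bigo_pow_scaleR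
            bigo_pow_mono[OF bigo_pow_power lim]) auto
    then show ?case
      by (rule bigo_pow_cong) (use stage[OF Suc.prems(2)] in eventually_elim, simp)
  qed
  define \<kappa> where "\<kappa> i = (\<Sum>l\<in>K. \<alpha> \<nu> i l * C l ^ k)" for i
  have Z': "bigo_pow ?F fst (k + 2) (\<lambda>x. snd x i - fst x ^ (k + 1) *\<^sub>R (\<kappa> i *\<^sub>R ?e))" if "i \<in> K" for i
  proof -
    have "bigo_pow ?F fst (Suc (k + 1)) (\<lambda>x. fst x *\<^sub>R (\<Sum>l\<in>K. \<alpha> \<sigma> i l *\<^sub>R snd x l))"
      by (intro bigo_pow_times bigo_pow_sum bigo_pow_scaleR Z) auto
    moreover have "bigo_pow ?F fst (k + 2)
        (\<lambda>x. fst x ^ (k + 2) *\<^sub>R (\<Sum>l\<in>K. (\<alpha> \<sigma> i l * C l ^ (k + 1) / (real k + 1)) *\<^sub>R ?e))"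
      by (rule bigo_pow_power)
    ultimately have "bigo_pow ?F fst (k + 2) (\<lambda>x. fst x *\<^sub>R (\<Sum>l\<in>K. \<alpha> \<sigma> i l *\<^sub>R snd x l)
      - fst x ^ (k + 2) *\<^sub>R (\<Sum>l\<in>K. (\<alpha> \<sigma> i l * C l ^ (k + 1) / (real k + 1)) *\<^sub>R ?e))"
      by (intro bigo_pow_diff) auto
    then show ?thesis
      by (rule bigo_pow_cong) (use stage[OF that] in eventually_elim, simp add: \<kappa>_def)
  qed
  have q1: "(\<Sum>l\<in>K. \<beta> \<nu> l * C l ^ k) = 1 / (real k + 1)"
    using assms by (intro additive_order_quadrature) auto
  have q2: "(\<Sum>l\<in>K. \<beta> \<sigma> l * C l ^ (k + 1)) = 1 / (real k + 2)"
    using additive_order_quadrature[OF assms(1-3), of "k + 1"] assms(5) by simp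
  let ?c = "(\<Sum>i\<in>K. \<beta> \<sigma> i * \<kappa> i) - 1 / ((real k + 1) * (real k + 2))"
  have rest: "bigo_pow ?F fst (Suc (k + 2))
      (\<lambda>x. fst x *\<^sub>R (\<Sum>i\<in>K. \<beta> \<sigma> i *\<^sub>R (snd x i - fst x ^ (k + 1) *\<^sub>R (\<kappa> i *\<^sub>R ?e))))"
    by (intro bigo_pow_times bigo_pow_sum bigo_pow_scaleR Z')
  have "bigo_pow ?F fst (Suc (k + 2)) ?err"
    using assms(5) by (intro bigo_pow_mono[OF o lim]) simp
  \<comment> \<open>Subtracting \<open>rest\<close> replaces the stages by their leading terms. Then
    \<open>q1\<close> removes the terms of order \<open>k + 1\<close>, and \<open>q2\<close> turns
    the exact-solution part into \<open>1 / ((k + 1) * (k + 2))\<close>.\<close>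
  from bigo_pow_diff[OF this rest]
  have "bigo_pow ?F fst (Suc (k + 2)) (\<lambda>x. fst x ^ (k + 2) *\<^sub>R (?c *\<^sub>R ?e))"
  proof (rule bigo_pow_eq)
    fix x :: "real \<times> ('k \<Rightarrow> real ^ 'd)"
    have 1: "(\<Sum>i\<in>K. \<beta> \<sigma> i *\<^sub>R (snd x i - fst x ^ (k + 1) *\<^sub>R (\<kappa> i *\<^sub>R ?e)))
        = (\<Sum>i\<in>K. \<beta> \<sigma> i *\<^sub>R snd x i) - fst x ^ (k + 1) *\<^sub>R ((\<Sum>i\<in>K. \<beta> \<sigma> i * \<kappa> i) *\<^sub>R ?e)"
      by (simp add: scaleR_diff_right sum_subtractf scaleR_sum_left scaleR_sum_right mult_ac)
    have 2: "(\<Sum>l\<in>K. (\<beta> \<sigma> l * C l ^ (k + 1) / (real k + 1)) *\<^sub>R ?e) = (1 / ((real k + 1) * (real k + 2))) *\<^sub>R ?e"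
      unfolding scaleR_sum_left[symmetric] sum_divide_distrib[symmetric] q2 by simp
    show "?err x - fst x *\<^sub>R (\<Sum>i\<in>K. \<beta> \<sigma> i *\<^sub>R (snd x i - fst x ^ (k + 1) *\<^sub>R (\<kappa> i *\<^sub>R ?e)))
        = fst x ^ (k + 2) *\<^sub>R (?c *\<^sub>R ?e)"
      unfolding sum_f 1 2 q1
      by (simp add: scaleR_diff_right scaleR_add_right scaleR_diff_left algebra_simps)
  qed
  then have "?c *\<^sub>R ?e = 0"
    by (rule bigo_pow_const_unique[OF _ lim eventually_fst_step_filter nontrivial])
  then show ?thesis by (simp add: \<kappa>_def)
qed

section \<open>Runge-Kutta and two-tableau methods in additive form\<close>

declare One_nat_def [simp del]

text \<open>Only positive steps matter along \<open>at_right 0\<close>. The restriction is essential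
  later, since the fast problem contains a division by \<open>c i * H\<close>.\<close>

lemma local_error_order_cong:
  assumes "\<And>r H y1. H > 0 \<Longrightarrow> step r H y1 \<longleftrightarrow> step' r H y1"
  shows "local_error_order p y t0 step \<longleftrightarrow> local_error_order p y t0 step'"
proof -
  have pos: "eventually (\<lambda>H::real. H > 0) (at_right 0)" by (rule eventually_at_right_less)
  show ?thesis
    unfolding local_error_order_def
    by (intro ex_cong1 conj_cong refl eventually_cong[OF pos]) (simp_all add: assms)
qed

lemma rk_accurate_imp_additive:
  assumes "rk_accurate TYPE('d::finite) s A b p"
  shows "additive_accurate TYPE('d) {1..s} (UNIV :: unit set) (\<lambda>_. A) (\<lambda>_. b) (abscissae s A) p"
proof -
  have "rk_step s A b (f ()) t y = additive_step {1..s} UNIV (\<lambda>_. A) (\<lambda>_. b) (abscissae s A) f t y"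
    for f :: "unit \<Rightarrow> 'd rhs" and t y
    by (intro ext) (auto simp: rk_step_def additive_step_def rk_stages_def additive_stages_def
        rk_result_def UNIV_unit)
  then show ?thesis
    using assms unfolding rk_accurate_def additive_accurate_def UNIV_unit
    by (simp, metis)
qed

text \<open>\<open>ark_step\<close> evaluates each colour at the row sums of its own tableau,
  whereas an additive method has one vector of abscissae; the assumptions on \<open>c\<close>
  identify them. \<open>True\<close> stands for the explicit colour and \<open>False\<close> for the
  implicit one.\<close>

lemma ark_accurate_imp_additive:
  assumes "ark_accurate TYPE('d::finite) s aE bE aI bI p"
    and c: "\<And>j. j \<in> {1..s} \<Longrightarrow> abscissae s aE j = c j" "\<And>j. j \<in> {1..s} \<Longrightarrow> abscissae s aI j = c j"
  shows "additive_accurate TYPE('d) {1..s} (UNIV :: bool set) (\<lambda>\<sigma>. if \<sigma> then aE else aI)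
    (\<lambda>\<sigma>. if \<sigma> then bE else bI) c p"
proof -
  have step: "ark_step s aE bE aI bI (f True) (f False) t y
      = additive_step {1..s} UNIV (\<lambda>\<sigma>. if \<sigma> then aE else aI) (\<lambda>\<sigma>. if \<sigma> then bE else bI) c f t y"
    for f :: "bool \<Rightarrow> 'd rhs" and t y
  proof (intro ext)
    fix r H y1
    have sums: "(\<Sum>j=1..s. w True j *\<^sub>R f True (t + abscissae s aE j * H) (Y j)
          + w False j *\<^sub>R f False (t + abscissae s aI j * H) (Y j))
        = (\<Sum>\<sigma>\<in>UNIV. \<Sum>j=1..s. w \<sigma> j *\<^sub>R f \<sigma> (t + c j * H) (Y j))" for w Y
    proof -
      have "(\<Sum>j=1..s. w True j *\<^sub>R f True (t + abscissae s aE j * H) (Y j)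
          + w False j *\<^sub>R f False (t + abscissae s aI j * H) (Y j))
        = (\<Sum>j=1..s. w True j *\<^sub>R f True (t + c j * H) (Y j)
          + w False j *\<^sub>R f False (t + c j * H) (Y j))"
        by (intro sum.cong refl) (simp only: c)
      then show ?thesis by (simp add: UNIV_bool sum.distrib add.commute)
    qed
    show "ark_step s aE bE aI bI (f True) (f False) t y r H y1
        = additive_step {1..s} UNIV (\<lambda>\<sigma>. if \<sigma> then aE else aI) (\<lambda>\<sigma>. if \<sigma> then bE else bI) c f t y r H y1"
      unfolding ark_step_def additive_step_def ark_stages_def additive_stages_def
        sums[symmetric] by simp
  qed
  obtain m where m: "\<And>(fE :: 'd rhs) fI t0 T y. smooth_rhs m fE \<Longrightarrow> smooth_rhs m fI \<Longrightarrow>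
        exact_solution (\<lambda>t x. fE t x + fI t x) t0 T y \<Longrightarrow>
        local_error_order p y t0 (ark_step s aE bE aI bI fE fI t0 (y t0))"
    using assms(1) unfolding ark_accurate_def by blast
  show ?thesis
    unfolding additive_accurate_def
  proof (intro exI[of _ m] allI impI)
    fix f :: "bool \<Rightarrow> 'd rhs" and t0 T y
    assume "\<forall>\<sigma>\<in>UNIV. smooth_rhs m (f \<sigma>)" "exact_solution (\<lambda>t x. \<Sum>\<sigma>\<in>UNIV. f \<sigma> t x) t0 T y"
    then show "local_error_order p y t0 (additive_step {1..s} UNIV (\<lambda>\<sigma>. if \<sigma> then aE else aI)
        (\<lambda>\<sigma>. if \<sigma> then bE else bI) c f t0 (y t0))"
      using m[of "f True" "f False" t0 T y] by (simp add: step UNIV_bool add.commute)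
  qed
qed

section \<open>IMEX-MRI-SR methods as additive methods\<close>

datatype part = Fast | Implicit | Explicit

lemma UNIV_part: "(UNIV :: part set) = {Fast, Implicit, Explicit}"
  using part.exhaust by auto

lemma sum_part: "(\<Sum>\<sigma>\<in>UNIV. h \<sigma>) = h Fast + h Implicit + h Explicit"
  by (simp add: UNIV_part add.assoc)

text \<open>The GARK blocks padded with zeros: \<open>Inl\<close> indexes slow stages and
  \<open>Inr\<close> fast ones. The fast colour is evaluated only at fast stages and the slow
  colours only at slow stages, so the remaining columns are zero.\<close>

fun mri_matrix ::
  "nat \<Rightarrow> (nat \<Rightarrow> nat \<Rightarrow> nat \<Rightarrow> real) \<Rightarrow> (nat \<Rightarrow> nat \<Rightarrow> real) \<Rightarrow> (nat \<Rightarrow> real)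
     \<Rightarrow> nat \<Rightarrow> (nat \<Rightarrow> nat \<Rightarrow> real) \<Rightarrow> (nat \<Rightarrow> real) \<Rightarrow> part \<Rightarrow> nat + nat \<times> nat \<Rightarrow> nat + nat \<times> nat \<Rightarrow> real"
where
  "mri_matrix n \<Omega> \<Gamma> c sF A b Fast (Inl i) (Inr x) = gark_SF c b i x"
| "mri_matrix n \<Omega> \<Gamma> c sF A b Fast (Inr z) (Inr x) = gark_FF c A z x"
| "mri_matrix n \<Omega> \<Gamma> c sF A b Implicit (Inl i) (Inl l) = gark_SI n \<Omega> \<Gamma> i l"
| "mri_matrix n \<Omega> \<Gamma> c sF A b Implicit (Inr z) (Inl l) = gark_FI n \<Omega> sF A z l"
| "mri_matrix n \<Omega> \<Gamma> c sF A b Explicit (Inl i) (Inl l) = gark_SE n \<Omega> i l"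
| "mri_matrix n \<Omega> \<Gamma> c sF A b Explicit (Inr z) (Inl l) = gark_FE n \<Omega> sF A z l"
| "mri_matrix n \<Omega> \<Gamma> c sF A b _ _ _ = 0"

definition mri_abscissa :: "(nat \<Rightarrow> real) \<Rightarrow> nat \<Rightarrow> (nat \<Rightarrow> nat \<Rightarrow> real) \<Rightarrow> nat + nat \<times> nat \<Rightarrow> real" where
  "mri_abscissa c sF A = case_sum c (\<lambda>(i, j). c i * abscissae sF A j)"

text \<open>The GARK form has fast stages for slow index 1 as well, which the method itself lacks;
  they turn out to equal the initial value.\<close>

definition mri_index :: "nat \<Rightarrow> nat \<Rightarrow> (nat + nat \<times> nat) set" where
  "mri_index s sF = {1..s} <+> {1..s} \<times> {1..sF}"

lemma finite_mri_index [simp]: "finite (mri_index s sF)"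
  by (simp add: mri_index_def)

lemma sum_mri_index:
  "(\<Sum>k\<in>mri_index s sF. h k) = (\<Sum>i=1..s. h (Inl i)) + (\<Sum>x\<in>{1..s} \<times> {1..sF}. h (Inr x))"
  by (simp add: mri_index_def sum.Plus o_def)

lemma ball_mri_index:
  "(\<forall>k\<in>mri_index s sF. P k) \<longleftrightarrow>
     (\<forall>i\<in>{1..s}. P (Inl i)) \<and> (\<forall>i\<in>{1..s}. \<forall>j\<in>{1..sF}. P (Inr (i, j)))"
  by (force simp: mri_index_def)

lemma sum_block_row:
  fixes h :: "nat \<times> nat \<Rightarrow> 'a::real_vector"
  assumes "i \<in> {1..s}"
  shows "(\<Sum>x\<in>{1..s} \<times> {1..sF}. gark_SF c w i x *\<^sub>R h x) = (\<Sum>l=1..sF. (c i * w l) *\<^sub>R h (i, l))"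
proof -
  have "(\<Sum>x\<in>{1..s} \<times> {1..sF}. gark_SF c w i x *\<^sub>R h x)
      = (\<Sum>k=1..s. if i = k then (\<Sum>l=1..sF. (c i * w l) *\<^sub>R h (i, l)) else 0)"
    unfolding sum.cartesian_product'
    by (intro sum.cong) (auto simp: gark_SF_def)
  then show ?thesis using assms by simp
qed

lemma sum_block_row_real:
  assumes "i \<in> {1..s}"
  shows "(\<Sum>x\<in>{1..s} \<times> {1..sF}. gark_SF c w i x * h x) = c i * (\<Sum>l=1..sF. w l * h (i, l))"
  using sum_block_row[OF assms, where h = h] by (simp add: sum_distrib_left mult.assoc)

text \<open>A fast stage is a fast result with a row of \<open>A\<close> as weights in place of
  \<open>b\<close>, so both are treated with one generic weight vector.\<close>

lemma gark_FF_eq_SF: "gark_FF c A (i, j) = gark_SF c (A j) i"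
  by (auto simp: gark_FF_def gark_SF_def)

text \<open>The step length \<open>c i * H\<close> cancels the factor \<open>1 / c i\<close> before
  the slow forcing, and evaluating the polynomial \<open>omega\<close> at the abscissae turns it
  into power sums. \<open>w\<close> will be \<open>b\<close> or a row of \<open>A\<close>.\<close>

lemma fast_increment:
  fixes fF fI fE :: "('d::finite) rhs"
  assumes mri: "imex_mri_sr s n \<Omega> \<Gamma> c" and i: "i \<in> {2..s}" and H: "H \<noteq> 0"
  shows "(c i * H) *\<^sub>R (\<Sum>q=1..sF. w q *\<^sub>R
      fast_rhs n \<Omega> c fF fI fE t H Y i (0 + a q * (c i * H)) (V q))
    = H *\<^sub>R ((\<Sum>q=1..sF. (c i * w q) *\<^sub>R fF (t + (c i * a q) * H) (V q))
       + (\<Sum>l=1..s. (\<Sum>k<n. \<Omega> k i l * (\<Sum>q=1..sF. w q * a q ^ k)) *\<^sub>R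
           (fE (t + c l * H) (Y l) + fI (t + c l * H) (Y l))))"
proof -
  let ?g = "\<lambda>l. fE (t + c l * H) (Y l) + fI (t + c l * H) (Y l)"
  have c: "c i \<noteq> 0" using mri i by (simp add: imex_mri_sr_def)
  have omega0: "omega n \<Omega> i l \<tau> = 0" if "l \<in> {1..s}" "i \<le> l" for l \<tau>
    using mri i that by (simp add: omega_def imex_mri_sr_def)
  \<comment> \<open>Strict lower triangularity of the \<open>\<Omega>\<close> matrices lets the sum
    over earlier stages run over all slow stages.\<close>
  have sum: "(\<Sum>l=1..<i. omega n \<Omega> i l \<tau> *\<^sub>R ?g l) = (\<Sum>l=1..s. omega n \<Omega> i l \<tau> *\<^sub>R ?g l)" for \<tau>
    by (rule sum.mono_neutral_left) (use i omega0 in auto)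
  have coeff: "(\<Sum>k<n. \<Omega> k i l * (\<Sum>q=1..sF. w q * a q ^ k)) = (\<Sum>q=1..sF. w q * omega n \<Omega> i l (a q))" for l
    unfolding omega_def sum_distrib_left
    by (subst sum.swap) (simp add: mult_ac)
  have "(c i * H) *\<^sub>R (w q *\<^sub>R fast_rhs n \<Omega> c fF fI fE t H Y i (0 + a q * (c i * H)) (V q))
      = H *\<^sub>R ((c i * w q) *\<^sub>R fF (t + (c i * a q) * H) (V q)
          + (\<Sum>l=1..s. (w q * omega n \<Omega> i l (a q)) *\<^sub>R ?g l))" for q
    using c H unfolding fast_rhs_def sum
    by (simp add: scaleR_add_right scaleR_sum_right mult_ac)
  then show ?thesis
    unfolding coeff scaleR_sum_left
    by (simp add: scaleR_sum_right sum.distrib scaleR_add_right)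
       (intro arg_cong2[of _ _ _ _ "(+)"] sum.swap)
qed

text \<open>
  The slow coefficients of the step agree with \<open>Omega_bar\<close> only because the fast quadrature
  integrates \<open>\<tau> ^ k\<close> exactly for \<open>k < n\<close>.
\<close>

lemma additive_stages_mri_iff:
  fixes fF fI fE :: "('d::finite) rhs"
  assumes mri: "imex_mri_sr s n \<Omega> \<Gamma> c"
    and quad: "\<And>k. k < n \<Longrightarrow> (\<Sum>q=1..sF. b q * abscissae sF A q ^ k) = 1 / (real k + 1)"
    and H: "H \<noteq> 0"
  shows "additive_stages (mri_index s sF) UNIV (mri_matrix n \<Omega> \<Gamma> c sF A b) (mri_abscissa c sF A)
      (case_part fF fI fE) t y H Z \<longleftrightarrow>
    mri_stages s n \<Omega> \<Gamma> c sF A b fF fI fE t y H (\<lambda>i j. Z (Inr (i, j))) (\<lambda>i. Z (Inl i)) \<and>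
    (\<forall>j\<in>{1..sF}. Z (Inr (1, j)) = y)"
proof -
  let ?R = "\<lambda>k. y + H *\<^sub>R (\<Sum>\<sigma>\<in>UNIV. \<Sum>l\<in>mri_index s sF. mri_matrix n \<Omega> \<Gamma> c sF A b \<sigma> k l *\<^sub>R
      case_part fF fI fE \<sigma> (t + mri_abscissa c sF A l * H) (Z l))"
  let ?fast = "\<lambda>i. fast_rhs n \<Omega> c fF fI fE t H (\<lambda>i. Z (Inl i)) i"
  let ?g = "\<lambda>l. fE (t + c l * H) (Z (Inl l)) + fI (t + c l * H) (Z (Inl l))"
  have s: "1 \<le> s" and c1: "c 1 = 0"
    and \<Omega>: "\<And>k i j. k < n \<Longrightarrow> i \<in> {1..s} \<Longrightarrow> j \<in> {1..s} \<Longrightarrow> i \<le> j \<Longrightarrow> \<Omega> k i j = 0"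
    and \<Gamma>: "\<And>i j. i \<in> {1..s} \<Longrightarrow> j \<in> {1..s} \<Longrightarrow> i < j \<Longrightarrow> \<Gamma> i j = 0"
    and \<Gamma>1: "\<And>j. j \<in> {1..s} \<Longrightarrow> \<Gamma> 1 j = 0"
    using mri by (auto simp: imex_mri_sr_def)
  have slow: "?R (Inl i) = y + H *\<^sub>R ((\<Sum>q=1..sF. (c i * b q) *\<^sub>R fF (t + (c i * abscissae sF A q) * H) (Z (Inr (i, q))))
      + (\<Sum>l=1..s. Omega_bar n \<Omega> i l *\<^sub>R ?g l)) + H *\<^sub>R (\<Sum>l=1..s. \<Gamma> i l *\<^sub>R fI (t + c l * H) (Z (Inl l)))"
    if "i \<in> {1..s}" for i
    using that
    by (simp add: sum_part sum_mri_index sum_block_row mri_abscissa_def Omega_bar_Gamma_def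
        scaleR_add_left scaleR_add_right sum.distrib)
  have fast: "?R (Inr (i, j)) = y + H *\<^sub>R ((\<Sum>q=1..sF. (c i * A j q) *\<^sub>R fF (t + (c i * abscissae sF A q) * H) (Z (Inr (i, q))))
      + (\<Sum>l=1..s. gark_FE n \<Omega> sF A (i, j) l *\<^sub>R ?g l))"
    if "i \<in> {1..s}" for i j
    using that
    by (simp add: sum_part sum_mri_index gark_FF_eq_SF sum_block_row mri_abscissa_def
        scaleR_add_right sum.distrib)
  have FE: "gark_FE n \<Omega> sF A (i, j) l = (\<Sum>k<n. \<Omega> k i l * (\<Sum>q=1..sF. A j q * abscissae sF A q ^ k))" for i j l
    by (simp add: gark_FE_def)
  have Ob: "Omega_bar n \<Omega> i l = (\<Sum>k<n. \<Omega> k i l * (\<Sum>q=1..sF. b q * abscissae sF A q ^ k))" for i l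
    unfolding Omega_bar_def by (intro sum.cong) (auto simp: quad)
  \<comment> \<open>The first slow row is empty: \<open>c 1 = 0\<close> removes the fast block,
    strict triangularity the \<open>\<Omega>\<close> part, and the zero first row of
    \<open>\<Gamma>\<close> the rest.\<close>
  have slow_1: "?R (Inl 1) = y"
    using s c1 \<Gamma>1 by (subst slow) (auto simp: Ob \<Omega>)
  have fast_1: "?R (Inr (1, j)) = y" for j
    using s c1 by (subst fast) (auto simp: FE \<Omega>)
  have slow_i: "?R (Inl i) = rk_result sF A b (?fast i) 0 y (c i * H) (\<lambda>j. Z (Inr (i, j)))
      + H *\<^sub>R (\<Sum>j=1..i. \<Gamma> i j *\<^sub>R fI (t + c j * H) (Z (Inl j)))" if i: "i \<in> {2..s}" for i
  proof -
    have "(\<Sum>l=1..s. \<Gamma> i l *\<^sub>R fI (t + c l * H) (Z (Inl l))) = (\<Sum>l=1..i. \<Gamma> i l *\<^sub>R fI (t + c l * H) (Z (Inl l)))"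
      by (rule sum.mono_neutral_right) (use i \<Gamma> in auto)
    then show ?thesis
      unfolding rk_result_def fast_increment[OF mri i H] using i by (subst slow) (auto simp: Ob)
  qed
  have fast_i: "?R (Inr (i, j)) = y + (c i * H) *\<^sub>R
      (\<Sum>q=1..sF. A j q *\<^sub>R ?fast i (0 + abscissae sF A q * (c i * H)) (Z (Inr (i, q))))" if i: "i \<in> {2..s}" for i j
    unfolding fast_increment[OF mri i H] using i by (subst fast) (auto simp: FE)
  have split: "(\<forall>i\<in>{1..s}. P i) \<longleftrightarrow> P 1 \<and> (\<forall>i\<in>{2..s}. P i)" for P
  proof -
    have "{1..s} = insert 1 {2..s}" using s by auto
    then show ?thesis by simp
  qed
  have "additive_stages (mri_index s sF) UNIV (mri_matrix n \<Omega> \<Gamma> c sF A b) (mri_abscissa c sF A)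
      (case_part fF fI fE) t y H Z \<longleftrightarrow>
    (\<forall>i\<in>{1..s}. Z (Inl i) = ?R (Inl i)) \<and> (\<forall>i\<in>{1..s}. \<forall>j\<in>{1..sF}. Z (Inr (i, j)) = ?R (Inr (i, j)))"
    unfolding additive_stages_def ball_mri_index ..
  also have "\<dots> \<longleftrightarrow> (Z (Inl 1) = y \<and> (\<forall>i\<in>{2..s}. Z (Inl i) = ?R (Inl i))) \<and>
      ((\<forall>j\<in>{1..sF}. Z (Inr (1, j)) = y) \<and> (\<forall>i\<in>{2..s}. \<forall>j\<in>{1..sF}. Z (Inr (i, j)) = ?R (Inr (i, j))))"
    unfolding split slow_1 fast_1 ..
  also have "\<dots> \<longleftrightarrow> mri_stages s n \<Omega> \<Gamma> c sF A b fF fI fE t y H (\<lambda>i j. Z (Inr (i, j))) (\<lambda>i. Z (Inl i)) \<and>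
    (\<forall>j\<in>{1..sF}. Z (Inr (1, j)) = y)"
    unfolding mri_stages_def rk_stages_def using slow_i fast_i by auto
  finally show ?thesis .
qed

lemma additive_step_mri_iff:
  fixes fF fI fE :: "('d::finite) rhs"
  assumes mri: "imex_mri_sr s n \<Omega> \<Gamma> c"
    and quad: "\<And>k. k < n \<Longrightarrow> (\<Sum>q=1..sF. b q * abscissae sF A q ^ k) = 1 / (real k + 1)"
    and H: "H \<noteq> 0"
  shows "mri_step s n \<Omega> \<Gamma> c sF A b fF fI fE t y r H y1 \<longleftrightarrow>
    additive_step (mri_index s sF) UNIV (mri_matrix n \<Omega> \<Gamma> c sF A b)
      (\<lambda>\<sigma>. mri_matrix n \<Omega> \<Gamma> c sF A b \<sigma> (Inl s)) (mri_abscissa c sF A) (case_part fF fI fE) t y r H y1"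
    (is "?mri \<longleftrightarrow> ?add")
proof -
  let ?stages = "additive_stages (mri_index s sF) UNIV (mri_matrix n \<Omega> \<Gamma> c sF A b) (mri_abscissa c sF A)
      (case_part fF fI fE) t y H"
  have iff: "?stages Z \<longleftrightarrow>
      mri_stages s n \<Omega> \<Gamma> c sF A b fF fI fE t y H (\<lambda>i j. Z (Inr (i, j))) (\<lambda>i. Z (Inl i)) \<and>
      (\<forall>j\<in>{1..sF}. Z (Inr (1, j)) = y)" for Z
    by (rule additive_stages_mri_iff[OF mri _ H]) (rule quad)
  have s: "s \<ge> 1" using mri by (simp add: imex_mri_sr_def)
  then have s_mem: "Inl s \<in> mri_index s sF" by (auto simp: mri_index_def)
  \<comment> \<open>The weights are the tableau rows of \<open>Inl s\<close>, so the result of the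
    additive step is the last slow stage.\<close>
  have add: "?add \<longleftrightarrow> (\<exists>Z. ?stages Z \<and> (\<forall>k\<in>mri_index s sF. norm (Z k - y) \<le> r) \<and> y1 = Z (Inl s))"
    unfolding additive_step_def
    by (rule ex_cong1) (use s_mem in \<open>auto simp: additive_stages_def\<close>)
  show ?thesis
  proof
    assume ?mri
    then obtain V Y where st: "mri_stages s n \<Omega> \<Gamma> c sF A b fF fI fE t y H V Y"
      and Y: "\<forall>i\<in>{1..s}. norm (Y i - y) \<le> r"
      and V: "\<forall>i\<in>{2..s}. \<forall>j\<in>{1..sF}. norm (V i j - y) \<le> r" and y1: "y1 = Y s"
      unfolding mri_step_def by blast
    \<comment> \<open>The extra fast stages of slow index 1 must be given the value
      \<open>y\<close>, the only one their stage equations allow.\<close>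
    define Z where "Z = case_sum Y (\<lambda>(i, j). if i = 1 then y else V i j)"
    have "mri_stages s n \<Omega> \<Gamma> c sF A b fF fI fE t y H (\<lambda>i j. Z (Inr (i, j))) (\<lambda>i. Z (Inl i))"
      using st by (simp add: mri_stages_def Z_def)
    then have "?stages Z" unfolding iff by (simp add: Z_def)
    \<comment> \<open>The extra stages have distance 0 from \<open>y\<close>, so they lie in the
      ball once \<open>r\<close> is nonnegative; the first slow stage guarantees this.\<close>
    moreover have "norm (Y 1 - y) = 0" using st by (simp add: mri_stages_def)
    then have "r \<ge> 0" using bspec[OF Y, of 1] s by simp
    then have "\<forall>k\<in>mri_index s sF. norm (Z k - y) \<le> r"
      using Y V unfolding ball_mri_index by (auto simp: Z_def)
    ultimately show ?add unfolding add using y1 by (intro exI[of _ Z]) (simp add: Z_def)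
  next
    assume ?add
    then obtain Z where "?stages Z" and Z: "\<forall>k\<in>mri_index s sF. norm (Z k - y) \<le> r" and y1: "y1 = Z (Inl s)"
      unfolding add by blast
    then have "mri_stages s n \<Omega> \<Gamma> c sF A b fF fI fE t y H (\<lambda>i j. Z (Inr (i, j))) (\<lambda>i. Z (Inl i))"
      unfolding iff by blast
    then show ?mri
      unfolding mri_step_def using Z y1 unfolding ball_mri_index
      by (intro exI[of _ "\<lambda>i j. Z (Inr (i, j))"] exI[of _ "\<lambda>i. Z (Inl i)"]) auto
  qed
qed

lemma mri_accurate_if_additive:
  assumes mri: "imex_mri_sr s n \<Omega> \<Gamma> c"
    and quad: "\<And>k. k < n \<Longrightarrow> (\<Sum>q=1..sF. b q * abscissae sF A q ^ k) = 1 / (real k + 1)"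
    and additive: "additive_accurate TYPE('d::finite) (mri_index s sF) UNIV (mri_matrix n \<Omega> \<Gamma> c sF A b)
      (\<lambda>\<sigma>. mri_matrix n \<Omega> \<Gamma> c sF A b \<sigma> (Inl s)) (mri_abscissa c sF A) p"
  shows "mri_accurate TYPE('d) s n \<Omega> \<Gamma> c sF A b p"
proof -
  let ?step = "additive_step (mri_index s sF) UNIV (mri_matrix n \<Omega> \<Gamma> c sF A b)
      (\<lambda>\<sigma>. mri_matrix n \<Omega> \<Gamma> c sF A b \<sigma> (Inl s)) (mri_abscissa c sF A)"
  obtain m where m: "\<And>(f :: part \<Rightarrow> 'd rhs) t0 T y. \<forall>\<sigma>\<in>UNIV. smooth_rhs m (f \<sigma>) \<Longrightarrow>
      exact_solution (\<lambda>t x. \<Sum>\<sigma>\<in>UNIV. f \<sigma> t x) t0 T y \<Longrightarrow>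
      local_error_order p y t0 (?step f t0 (y t0))"
    using additive unfolding additive_accurate_def by blast
  show ?thesis
    unfolding mri_accurate_def
  proof (intro exI[of _ m] allI impI)
    fix fF fI fE :: "'d rhs" and t0 T y
    assume smooth: "smooth_rhs m fF" "smooth_rhs m fI" "smooth_rhs m fE"
      and exact: "exact_solution (\<lambda>t x. fF t x + fI t x + fE t x) t0 T y"
    have "\<forall>\<sigma>\<in>UNIV. smooth_rhs m (case_part fF fI fE \<sigma>)"
      using smooth by (simp add: UNIV_part)
    moreover have "exact_solution (\<lambda>t x. \<Sum>\<sigma>\<in>UNIV. case_part fF fI fE \<sigma> t x) t0 T y"
      using exact by (simp add: sum_part)
    ultimately have "local_error_order p y t0 (?step (case_part fF fI fE) t0 (y t0))"
      by (rule m)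
    then show "local_error_order p y t0 (mri_step s n \<Omega> \<Gamma> c sF A b fF fI fE t0 (y t0))"
      by (rule iffD2[OF local_error_order_cong, rotated])
         (rule additive_step_mri_iff[OF mri], use quad in auto)
  qed
qed

section \<open>Third-order accuracy\<close>

theorem theorem2p5:
  fixes s n sF :: nat
    and \<Omega> :: "nat \<Rightarrow> nat \<Rightarrow> nat \<Rightarrow> real"
    and \<Gamma> A :: "nat \<Rightarrow> nat \<Rightarrow> real"
    and c b :: "nat \<Rightarrow> real"
  assumes "imex_mri_sr s n \<Omega> \<Gamma> c"
    and "internally_consistent s n \<Omega> \<Gamma> c sF A b"
    and "slow_base_accurate TYPE('d::finite) s n \<Omega> \<Gamma> 3"
    and "rk_accurate TYPE('d) sF A b (max 3 (n + 1))"
    and "(\<Sum>j=1..s. (\<Sum>k<n. 1 / ((real k + 1) * (real k + 2)) * \<Omega> k s j) * c j) = 1 / 6"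
  shows "mri_accurate TYPE('d) s n \<Omega> \<Gamma> c sF A b 3"
proof -
  let ?cF = "abscissae sF A"
  let ?\<alpha> = "mri_matrix n \<Omega> \<Gamma> c sF A b"
  let ?C = "mri_abscissa c sF A"
  have s: "s \<in> {1..s}" using assms(1) by (simp add: imex_mri_sr_def)

  note rk = rk_accurate_imp_additive[OF assms(4)]
  have fast_quad: "(\<Sum>l=1..sF. b l * ?cF l ^ k) = 1 / (real k + 1)" if "k < max 3 (n + 1)" for k
    using additive_order_quadrature[OF rk _ UNIV_I that] by simp
  \<comment> \<open>The range covers \<open>k = 1\<close>, which needs order 3, for the pair (fast,
    fast), and all \<open>k < n\<close>, which need order \<open>n + 1\<close>, for the pairs (fast,
    slow). Hence the maximum in the assumed order.\<close>
  have fast_coupling: "(\<Sum>j=1..sF. b j * (\<Sum>l=1..sF. A j l * ?cF l ^ k)) = 1 / ((real k + 1) * (real k + 2))"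
    if "k + 2 \<le> max 3 (n + 1)" for k
    using additive_order_coupling[OF rk _ UNIV_I UNIV_I that] by simp

  have cons_S: "(\<Sum>x\<in>{1..s} \<times> {1..sF}. gark_SF c b i x) = c i"
    "(\<Sum>l=1..s. Omega_bar n \<Omega> i l) = c i" "(\<Sum>l=1..s. Omega_bar_Gamma n \<Omega> \<Gamma> i l) = c i"
    if "i \<in> {1..s}" for i
    using assms(2) that unfolding internally_consistent_def row_sum_def by auto
  \<comment> \<open>The Kronecker block yields the value of this row sum; consistency then transfers
    it to the slow columns.\<close>
  have cons_FF: "(\<Sum>x\<in>{1..s} \<times> {1..sF}. gark_FF c A (i, j) x) = c i * ?cF j" if "i \<in> {1..s}" for i j
    using sum_block_row_real[OF that, where h = "\<lambda>_. 1"] by (simp add: gark_FF_eq_SF row_sum_def)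
  have cons_FE: "(\<Sum>l=1..s. gark_FE n \<Omega> sF A (i, j) l) = c i * ?cF j"
    if "i \<in> {1..s}" "j \<in> {1..sF}" for i j
    using assms(2) that cons_FF[of i j] unfolding internally_consistent_def row_sum_def by auto

  note ark = ark_accurate_imp_additive[OF assms(3)[unfolded slow_base_accurate_def], of c]
  let ?bS = "\<lambda>\<sigma>. if \<sigma> then Omega_bar n \<Omega> else Omega_bar_Gamma n \<Omega> \<Gamma>"
  have ark: "additive_accurate TYPE('d) {1..s} UNIV ?bS (\<lambda>\<sigma>. ?bS \<sigma> s) c 3"
    using ark cons_S by (simp add: row_sum_def if_distrib[of "\<lambda>f. f s"])
  have slow_quad: "(\<Sum>l=1..s. ?bS \<sigma> s l * c l ^ k) = 1 / (real k + 1)" if "k < 3" for k \<sigma>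
    using additive_order_quadrature[OF ark _ UNIV_I that, of \<sigma>] by simp
  have slow_coupling: "(\<Sum>i=1..s. ?bS \<sigma> s i * (\<Sum>l=1..s. ?bS \<nu> i l * c l)) = 1 / 6" for \<sigma> \<nu>
    using additive_order_coupling[OF ark _ UNIV_I UNIV_I, of 1 \<sigma> \<nu>] by simp
  \<comment> \<open>The explicit weights sum to 1 by accuracy, and they form row \<open>s\<close>,
    whose sum is \<open>c s\<close>.\<close>
  have cs: "c s = 1" using slow_quad[of 0 True] cons_S(2)[OF s] by simp

  show ?thesis
  proof (rule mri_accurate_if_additive[OF assms(1)])
    show "(\<Sum>q=1..sF. b q * ?cF q ^ k) = 1 / (real k + 1)" if "k < n" for k
      using that by (intro fast_quad) simp
    have C [simp]: "?C (Inl i) = c i" "?C (Inr (i, j)) = c i * ?cF j" for i j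
      by (simp_all add: mri_abscissa_def)
    have sum_\<beta>: "(\<Sum>k\<in>mri_index s sF. ?\<alpha> Fast (Inl i) k * h k) = c i * (\<Sum>l=1..sF. b l * h (Inr (i, l)))"
      "(\<Sum>k\<in>mri_index s sF. ?\<alpha> Implicit (Inl i) k * h k) = (\<Sum>l=1..s. ?bS False i l * h (Inl l))"
      "(\<Sum>k\<in>mri_index s sF. ?\<alpha> Explicit (Inl i) k * h k) = (\<Sum>l=1..s. ?bS True i l * h (Inl l))"
      if "i \<in> {1..s}" for i h
      using that by (simp_all add: sum_mri_index sum_block_row_real)
    have sum_F: "(\<Sum>k\<in>mri_index s sF. ?\<alpha> Fast (Inr (i, j)) k * h k) = c i * (\<Sum>l=1..sF. A j l * h (Inr (i, l)))"
      "(\<Sum>k\<in>mri_index s sF. ?\<alpha> Implicit (Inr (i, j)) k * h k) = (\<Sum>l=1..s. gark_FE n \<Omega> sF A (i, j) l * h (Inl l))"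
      "(\<Sum>k\<in>mri_index s sF. ?\<alpha> Explicit (Inr (i, j)) k * h k) = (\<Sum>l=1..s. gark_FE n \<Omega> sF A (i, j) l * h (Inl l))"
      if "i \<in> {1..s}" for i j h
      using that by (simp_all add: sum_mri_index gark_FF_eq_SF sum_block_row_real)
    note sums = sum_\<beta>[OF s] sum_F[OF s]
    show "additive_accurate TYPE('d) (mri_index s sF) UNIV ?\<alpha> (\<lambda>\<sigma>. ?\<alpha> \<sigma> (Inl s)) ?C 3"
    proof (rule additive_accurate_3I)
      show "finite (UNIV :: part set)" by (simp add: UNIV_part)
      show "(\<Sum>l\<in>mri_index s sF. ?\<alpha> \<sigma> k l) = ?C k" if "k \<in> mri_index s sF" for \<sigma> k
        using that
        by (cases \<sigma>) (auto simp: mri_index_def sum_mri_index[unfolded mri_index_def] cons_S cons_FF cons_FE)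
      show "(\<Sum>l\<in>mri_index s sF. ?\<alpha> \<sigma> (Inl s) l) = 1" for \<sigma>
        using sum_\<beta>[OF s, of "\<lambda>_. 1"] fast_quad[of 0] slow_quad[of 0 True] slow_quad[of 0 False] cs
        by (cases \<sigma>) simp_all
      show "(\<Sum>l\<in>mri_index s sF. ?\<alpha> \<sigma> (Inl s) l * ?C l) = 1 / 2" for \<sigma>
        using fast_quad[of 1] slow_quad[of 1 True] slow_quad[of 1 False] cs
        by (cases \<sigma>) (simp_all add: sums)
      show "(\<Sum>l\<in>mri_index s sF. ?\<alpha> \<sigma> (Inl s) l * (?C l)\<^sup>2) = 1 / 3" for \<sigma>
        using fast_quad[of 2] slow_quad[of 2 True] slow_quad[of 2 False] cs
        by (cases \<sigma>) (simp_all add: sums)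
      have fast_1: "(\<Sum>l=1..sF. b l * ?cF l) = 1 / 2" using fast_quad[of 1] by simp
      \<comment> \<open>Each inner sum is \<open>(c k)^2 / 2\<close>, because the fast step from 0
        to \<open>c k * H\<close> integrates linear functions exactly. The condition thus reduces to
        the slow quadrature of squares.\<close>
      have slow_fast: "(\<Sum>k=1..s. ?bS \<sigma> s k * (\<Sum>l\<in>mri_index s sF. ?\<alpha> Fast (Inl k) l * ?C l)) = 1 / 6" for \<sigma>
      proof -
        have row: "(\<Sum>l\<in>mri_index s sF. ?\<alpha> Fast (Inl k) l * ?C l) = (c k)\<^sup>2 / 2" if "k \<in> {1..s}" for k
        proof -
          have "(\<Sum>l=1..sF. b l * (c k * ?cF l)) = c k * (\<Sum>l=1..sF. b l * ?cF l)"
            by (simp add: sum_distrib_left mult_ac)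
          then show ?thesis using that by (simp add: sum_\<beta> fast_1 power2_eq_square)
        qed
        have "(\<Sum>k=1..s. ?bS \<sigma> s k * (\<Sum>l\<in>mri_index s sF. ?\<alpha> Fast (Inl k) l * ?C l))
            = (\<Sum>k=1..s. ?bS \<sigma> s k * (c k)\<^sup>2) / 2"
          unfolding sum_divide_distrib by (intro sum.cong refl) (simp only: row times_divide_eq_right)
        then show ?thesis using slow_quad[of 2 \<sigma>] by simp
      qed
      have slow_slow: "(\<Sum>k=1..s. ?bS \<sigma> s k * (\<Sum>l\<in>mri_index s sF. ?\<alpha> \<nu> (Inl k) l * ?C l)) = 1 / 6"
        if "\<nu> \<noteq> Fast" for \<sigma> \<nu>
      proof -
        have "(\<Sum>l\<in>mri_index s sF. ?\<alpha> \<nu> (Inl k) l * ?C l) = (\<Sum>l=1..s. ?bS (\<nu> = Explicit) k l * c l)"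
          if "k \<in> {1..s}" for k
          using that \<open>\<nu> \<noteq> Fast\<close> by (cases \<nu>) (simp_all add: sum_\<beta>)
        then show ?thesis using slow_coupling[of \<sigma> "\<nu> = Explicit"] by simp
      qed
      \<comment> \<open>One computation serves both slow colours, as they share the block
        \<open>gark_FE\<close>. \<open>\<Gamma>\<close> does not enter it, because the implicit
        correction is added after the fast solve.\<close>
      have fast_slow: "(\<Sum>j=1..sF. b j * (\<Sum>l=1..s. gark_FE n \<Omega> sF A (s, j) l * c l)) = 1 / 6"
      proof -
        have "(\<Sum>j=1..sF. b j * (\<Sum>l=1..s. gark_FE n \<Omega> sF A (s, j) l * c l))
            = (\<Sum>l=1..s. (\<Sum>j=1..sF. b j * gark_FE n \<Omega> sF A (s, j) l) * c l)"
          unfolding sum_distrib_left sum_distrib_right by (subst sum.swap) (simp add: mult_ac)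
        also have "\<dots> = (\<Sum>l=1..s. (\<Sum>k<n. 1 / ((real k + 1) * (real k + 2)) * \<Omega> k s l) * c l)"
        proof (rule sum.cong[OF refl])
          fix l
          have "(\<Sum>j=1..sF. b j * gark_FE n \<Omega> sF A (s, j) l)
              = (\<Sum>k<n. (\<Sum>j=1..sF. b j * (\<Sum>q=1..sF. A j q * ?cF q ^ k)) * \<Omega> k s l)"
            unfolding gark_FE_def prod.case sum_distrib_left sum_distrib_right
            by (subst sum.swap) (simp add: mult_ac)
          also have "\<dots> = (\<Sum>k<n. 1 / ((real k + 1) * (real k + 2)) * \<Omega> k s l)"
            by (intro sum.cong refl arg_cong2[of _ _ _ _ "(*)"] fast_coupling) auto
          finally show "(\<Sum>j=1..sF. b j * gark_FE n \<Omega> sF A (s, j) l) * c l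
              = (\<Sum>k<n. 1 / ((real k + 1) * (real k + 2)) * \<Omega> k s l) * c l" by simp
        qed
        finally show ?thesis using assms(5) by simp
      qed
      \<comment> \<open>All nine colour pairs. A fast outer colour reduces to the weights
        \<open>b\<close> on block \<open>s\<close>, where \<open>c s = 1\<close> makes the rescaled
        fast method the original one.\<close>
      show "(\<Sum>k\<in>mri_index s sF. ?\<alpha> \<sigma> (Inl s) k * (\<Sum>l\<in>mri_index s sF. ?\<alpha> \<nu> k l * ?C l)) = 1 / 6" for \<sigma> \<nu>
        using slow_fast[of True] slow_fast[of False] slow_slow[of \<nu> True] slow_slow[of \<nu> False]
          fast_slow fast_coupling[of 1] cs
        by (cases \<sigma>; cases \<nu>) (simp_all only: sums C, simp_all)
    qed simp
  qed
qed

end
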